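(* Let $\varphi:\mathbb{R}^n\to\mathbb{R}$ and $\Phi:\mathbb{R}^n\to\mathbb{R}^m$ be $\mathcal{C}^2$ functions, $g:\mathbb{R}^m\to\overline{\mathbb{R}}$ a polyhedral function, $L(x,\lambda)=\varphi(x)+\langle\lambda,\Phi(x)\rangle$, and define $\Psi:\mathbb{R}^n\times\mathbb{R}^m\rightrightarrows\mathbb{R}^n\times\mathbb{R}^m$ by $$\Psi(x,\lambda)=\begin{bmatrix}\nabla_x L(x,\lambda)\\ -\Phi(x)\end{bmatrix}+\begin{bmatrix}0\\ \partial g^*(\lambda)\end{bmatrix},$$ and $S_{KKT}=\Psi^{-1}$. Let $(\bar x,\bar\lambda)$ be a KKT point, i.e. $\nabla_x L(\bar x,\bar\lambda)=0$ and $\bar\lambda\in\partial g(\Phi(\bar x))$. Then the following are equivalent: (a) $\Psi$ is metrically regular at $(\bar x,\bar\lambda)$ for $(0,0)$; (b) $\Psi$ is strongly metrically regular at $(\bar x,\bar\lambda)$ for $(0,0)$; (c) $S_{KKT}$ has a Lipschitz continuous single-valued localization around $(0,0)$ for $(\bar x,\bar\lambda)$; (d) the implication $$\nabla^2_{xx}L(\bar x,\bar\lambda)w+\nabla\Phi(\bar x)^*w'=0,\quad w'\in D^*(\partial g)(\Phi(\bar x),\bar\lambda)(\nabla\Phi(\bar x)w)\ \Longrightarrow\ (w,w')=(0,0)$$ holds.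
   Context: A proper function $g:\mathbb{R}^m\to\overline{\mathbb{R}}$ is polyhedral if its epigraph is a polyhedral convex set; $\partial$ is the convex-analysis subdifferential and $g^*$ the Fenchel conjugate; $A^*$ is the transpose of a matrix $A$. $F:\mathbb{R}^p\rightrightarrows\mathbb{R}^q$ is metrically regular at $\bar x$ for $\bar y\in F(\bar x)$ if there are $\kappa\ge0$ and neighborhoods $U,V$ of $\bar x,\bar y$ with $\mathrm{dist}(x,F^{-1}(y))\le\kappa\,\mathrm{dist}(y,F(x))$ on $U\times V$; strongly metrically regular if $y\mapsto F^{-1}(y)\cap U$ is single-valued and Lipschitz on $V$ for some such neighborhoods. A Lipschitz continuous single-valued localization of $S$ around $\bar y$ for $\bar x$ means neighborhoods $U$ of $\bar x$, $V$ of $\bar y$ such that $y\mapsto S(y)\cap U$ is single-valued and Lipschitz on $V$. The coderivative is defined by $u\in D^*(\partial g)(\bar z,\bar\lambda)(w)\iff(u,-w)\in N_{\mathrm{gph}\,\partial g}(\bar z,\bar\lambda)$, where $N_\Omega$ is the limiting normal cone: $\bar v\in N_\Omega(\bar x)$ iff there are $x^k\to\bar x$ in $\Omega$ and $v^k\to\bar v$ with $v^k\in\widehat N_\Omega(x^k)=T_\Omega(x^k)^*$, $T_\Omega(x)=\limsup_{t\searrow0}(\Omega-x)/t$. *)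

theory Defs
  imports "HOL-Analysis.Analysis"
begin

definition C2 :: "('a::euclidean_space \<Rightarrow> 'c::euclidean_space) \<Rightarrow> bool" where
  "C2 f \<longleftrightarrow> (\<exists>(f' :: 'a \<Rightarrow> ('a \<Rightarrow>\<^sub>L 'c)) (f'' :: 'a \<Rightarrow> ('a \<Rightarrow>\<^sub>L ('a \<Rightarrow>\<^sub>L 'c))).
      (\<forall>x. (f has_derivative blinfun_apply (f' x)) (at x)) \<and>
      (\<forall>x. (f' has_derivative blinfun_apply (f'' x)) (at x)) \<and>
      continuous_on UNIV f'')"

definition grad :: "('a::euclidean_space \<Rightarrow> real) \<Rightarrow> 'a \<Rightarrow> 'a" where
  "grad f x = (\<Sum>i\<in>Basis. frechet_derivative f (at x) i *\<^sub>R i)"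

definition proper_fun :: "('b \<Rightarrow> ereal) \<Rightarrow> bool" where
  "proper_fun g \<longleftrightarrow> (\<forall>y. g y \<noteq> -\<infinity>) \<and> (\<exists>y. g y \<noteq> \<infinity>)"

definition epigraph :: "('b \<Rightarrow> ereal) \<Rightarrow> ('b \<times> real) set" where
  "epigraph g = {(y, t). g y \<le> ereal t}"

definition polyhedral_fun :: "('b::euclidean_space \<Rightarrow> ereal) \<Rightarrow> bool" where
  "polyhedral_fun g \<longleftrightarrow> proper_fun g \<and> polyhedron (epigraph g)"

definition fconj :: "('b::real_inner \<Rightarrow> ereal) \<Rightarrow> 'b \<Rightarrow> ereal" where
  "fconj g v = (SUP y. ereal (v \<bullet> y) - g y)"

definition subdiff :: "('b::real_inner \<Rightarrow> ereal) \<Rightarrow> 'b \<Rightarrow> 'b set" where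
  "subdiff h x = {v. \<bar>h x\<bar> \<noteq> \<infinity> \<and> (\<forall>z. h x + ereal (v \<bullet> (z - x)) \<le> h z)}"

definition tangent_cone :: "'a::real_normed_vector set \<Rightarrow> 'a \<Rightarrow> 'a set" where
  "tangent_cone \<Omega> x = {d. \<exists>t dd. (\<forall>k. 0 < t k) \<and> t \<longlonglongrightarrow> 0 \<and> dd \<longlonglongrightarrow> d \<and>
                              (\<forall>k. x + t k *\<^sub>R dd k \<in> \<Omega>)}"

definition frechet_normal :: "'a::real_inner set \<Rightarrow> 'a \<Rightarrow> 'a set" where
  "frechet_normal \<Omega> x = {v. \<forall>d\<in>tangent_cone \<Omega> x. v \<bullet> d \<le> 0}"

definition limiting_normal :: "'a::real_inner set \<Rightarrow> 'a \<Rightarrow> 'a set" where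
  "limiting_normal \<Omega> x = {v. \<exists>xk vk. (\<forall>k. xk k \<in> \<Omega>) \<and> xk \<longlonglongrightarrow> x \<and> vk \<longlonglongrightarrow> v \<and>
                              (\<forall>k. vk k \<in> frechet_normal \<Omega> (xk k))}"

definition graph :: "('a \<Rightarrow> 'c set) \<Rightarrow> ('a \<times> 'c) set" where
  "graph F = {(x, y). y \<in> F x}"

definition coderiv :: "('a::real_inner \<Rightarrow> 'c::real_inner set) \<Rightarrow> 'a \<times> 'c \<Rightarrow> 'c \<Rightarrow> 'a set" where
  "coderiv F zl w = {u. (u, - w) \<in> limiting_normal (graph F) zl}"

definition inv_map :: "('a \<Rightarrow> 'c set) \<Rightarrow> 'c \<Rightarrow> 'a set" where
  "inv_map F y = {x. y \<in> F x}"

definition setdist :: "'a::metric_space \<Rightarrow> 'a set \<Rightarrow> ereal" where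
  "setdist x A = (if A = {} then \<infinity> else ereal (infdist x A))"

definition metrically_regular :: "('a::metric_space \<Rightarrow> 'c::metric_space set) \<Rightarrow> 'a \<Rightarrow> 'c \<Rightarrow> bool" where
  "metrically_regular F xb yb \<longleftrightarrow>
     (\<exists>\<kappa>::real. \<exists>U V. 0 \<le> \<kappa> \<and> open U \<and> xb \<in> U \<and> open V \<and> yb \<in> V \<and>
        (\<forall>x\<in>U. \<forall>y\<in>V. setdist x (inv_map F y) \<le> ereal \<kappa> * setdist y (F x)))"

definition strongly_metrically_regular :: "('a::metric_space \<Rightarrow> 'c::metric_space set) \<Rightarrow> 'a \<Rightarrow> 'c \<Rightarrow> bool" where
  "strongly_metrically_regular F xb yb \<longleftrightarrow>
     (\<exists>U V s. open U \<and> xb \<in> U \<and> open V \<and> yb \<in> V \<and>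
        (\<forall>y\<in>V. inv_map F y \<inter> U = {s y}) \<and> (\<exists>C. C-lipschitz_on V s))"

definition lip_sv_localization :: "('c::metric_space \<Rightarrow> 'a::metric_space set) \<Rightarrow> 'c \<Rightarrow> 'a \<Rightarrow> bool" where
  "lip_sv_localization S yb xb \<longleftrightarrow>
     (\<exists>U V s. open U \<and> xb \<in> U \<and> open V \<and> yb \<in> V \<and>
        (\<forall>y\<in>V. S y \<inter> U = {s y}) \<and> (\<exists>C. C-lipschitz_on V s))"

definition gradL :: "('a::euclidean_space \<Rightarrow> real) \<Rightarrow> ('a \<Rightarrow> 'b::euclidean_space) \<Rightarrow> 'a \<Rightarrow> 'b \<Rightarrow> 'a" where
  "gradL \<phi> \<Phi> x l = grad (\<lambda>z. \<phi> z + l \<bullet> \<Phi> z) x"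

definition Psi :: "('a::euclidean_space \<Rightarrow> real) \<Rightarrow> ('a \<Rightarrow> 'b::euclidean_space) \<Rightarrow> ('b \<Rightarrow> ereal)
                   \<Rightarrow> 'a \<times> 'b \<Rightarrow> ('a \<times> 'b) set" where
  "Psi \<phi> \<Phi> g xl = {(gradL \<phi> \<Phi> (fst xl) (snd xl), - \<Phi> (fst xl) + u) | u. u \<in> subdiff (fconj g) (snd xl)}"

definition S_KKT :: "('a::euclidean_space \<Rightarrow> real) \<Rightarrow> ('a \<Rightarrow> 'b::euclidean_space) \<Rightarrow> ('b \<Rightarrow> ereal)
                   \<Rightarrow> 'a \<times> 'b \<Rightarrow> ('a \<times> 'b) set" where
  "S_KKT \<phi> \<Phi> g = inv_map (Psi \<phi> \<Phi> g)"

end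

theory Submission
  imports Defs
begin

text \<open>Only (a) implies (d) and (d) implies (b) need work. For the first, a limiting normal violating (d)
  is tested against the tangent directions that metric regularity produces when the right-hand side
  moves along \<open>(-w, w')\<close>; symmetry of the Hessian turns the normal inequality into
  \<open>|w|\<^sup>2 + |w'|\<^sup>2 \<le> 0\<close>.

  For the second, let \<open>G = \<partial>g*(lb)\<close>. Limiting normals to \<open>gph \<partial>g\<close> are
  produced only for the faces \<open>F\<close> of \<open>G\<close> through \<open>\<Phi>(xb)\<close> and for pairs of
  a face and one of its facets. As the Hessian is symmetric, going up a chain of facets shows that (d)
  forces a strict monotonicity on the span of \<open>G - \<Phi>(xb)\<close>: the sign of one extra direction is
  decided at each facet. Together with monotonicity of \<open>\<partial>g\<close> and strict differentiability this gives a
  Lipschitz estimate between any two solutions of the perturbed KKT system near the reference point.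
  Existence follows from invariance of domain, \<open>gph \<partial>g\<close> being parametrized by
  \<open>v = z + \<lambda>\<close> through the resolvent.\<close>

section \<open>The subdifferential of a polyhedral function as a relation\<close>

text \<open>The obstacle is a gap between two sets of pairs. Differences of two points of gph
  \<partial>g near the reference point lie in the set of \<open>(s, w')\<close> with
  \<open>s\<close> in the span of \<open>G - \<Phi>(xb)\<close>, \<open>w'\<close> orthogonal to the
  span of the smallest face through \<open>\<Phi>(xb)\<close>, and
  \<open>s \<bullet> w' \<ge> 0\<close>. For (b) it suffices that the linearised KKT system has no
  nonzero solution there, but (d) speaks of limiting normals only. The gap closes because on
  solutions of \<open>H w + adjoint J w' = 0\<close> symmetry of \<open>H\<close> makes
  \<open>J w \<bullet> w' = - (w \<bullet> H w)\<close> a symmetric form, so that squares can be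
  completed along a flag of faces, one direction per facet. Polyhedrality enters through finiteness:
  there are only finitely many sets \<partial>g*(l), so \<partial>g*(l) is contained in
  \<open>G\<close> for all \<open>l\<close> near \<open>lb\<close>, and every nonempty face of
  \<open>G\<close> is itself some \<partial>g*(l) with \<open>l\<close> arbitrarily near
  \<open>lb\<close>. The relation is stated through the epigraph \<open>E\<close>:
  \<open>(z, r)\<close> maximises \<open>l \<bullet> y - t\<close> over \<open>E\<close>, which
  forces \<open>r = g z\<close>. This keeps the arithmetic real and makes the faces of
  \<open>E\<close> available.\<close>

definition subgradient_rel :: "('b::euclidean_space \<times> real) set \<Rightarrow> ('b \<times> 'b) set" where
  "subgradient_rel E = {(z, l). \<exists>r. (z, r) \<in> E \<and> (\<forall>y t. (y, t) \<in> E \<longrightarrow> l \<bullet> y - t \<le> l \<bullet> z - r)}"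

lemma subgradient_relE:
  assumes "(z, l) \<in> subgradient_rel E"
  obtains r where "(z, r) \<in> E" "\<And>y t. (y, t) \<in> E \<Longrightarrow> l \<bullet> y - t \<le> l \<bullet> z - r"
  using assms unfolding subgradient_rel_def by blast

lemma subgradient_rel_monotone:
  assumes "(z, l) \<in> subgradient_rel E" "(z', l') \<in> subgradient_rel E"
  shows "0 \<le> (z - z') \<bullet> (l - l')"
proof -
  obtain r where r: "(z, r) \<in> E" "\<And>y t. (y, t) \<in> E \<Longrightarrow> l \<bullet> y - t \<le> l \<bullet> z - r"
    using subgradient_relE[OF assms(1)] by metis
  obtain r' where r': "(z', r') \<in> E" "\<And>y t. (y, t) \<in> E \<Longrightarrow> l' \<bullet> y - t \<le> l' \<bullet> z' - r'"
    using subgradient_relE[OF assms(2)] by metis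
  show ?thesis
    using r(2)[OF r'(1)] r'(2)[OF r(1)] by (simp add: inner_diff inner_commute algebra_simps)
qed

text \<open>As \<open>z\<close> and \<open>z'\<close> both belong to the face of \<open>l\<close>,
  the function grows from \<open>z\<close> to \<open>z'\<close> by exactly
  \<open>l \<bullet> (z' - z)\<close>, and the subgradient \<open>l'\<close> at \<open>z\<close>
  cannot predict more. Face directions and subgradient directions at \<open>z\<close> are thus
  mutually polar, which is where the second components of the normals below come from.\<close>

lemma subgradient_rel_cross:
  assumes "(z, l) \<in> subgradient_rel E" "(z', l) \<in> subgradient_rel E" "(z, l') \<in> subgradient_rel E"
  shows "(z' - z) \<bullet> (l' - l) \<le> 0"
proof -
  obtain r where r: "(z, r) \<in> E" "\<And>y t. (y, t) \<in> E \<Longrightarrow> l \<bullet> y - t \<le> l \<bullet> z - r"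
    using subgradient_relE[OF assms(1)] by metis
  obtain r' where r': "(z', r') \<in> E" "\<And>y t. (y, t) \<in> E \<Longrightarrow> l \<bullet> y - t \<le> l \<bullet> z' - r'"
    using subgradient_relE[OF assms(2)] by metis
  obtain s where s: "(z, s) \<in> E" "\<And>y t. (y, t) \<in> E \<Longrightarrow> l' \<bullet> y - t \<le> l' \<bullet> z - s"
    using subgradient_relE[OF assms(3)] by metis
  show ?thesis
    using r(2)[OF r'(1)] r'(2)[OF r(1)] s(2)[OF r'(1)] r(2)[OF s(1)]
    by (simp add: inner_diff inner_commute algebra_simps)
qed

text \<open>For the epigraph of \<open>g\<close> this is \<partial>g*(l); when nonempty, it is the
  projection of the face of \<open>E\<close> exposed by \<open>(l, -1)\<close>.\<close>

definition conj_face :: "('b::euclidean_space \<times> real) set \<Rightarrow> 'b \<Rightarrow> 'b set" where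
  "conj_face E l = {z. (z, l) \<in> subgradient_rel E}"

lemma mem_conj_face: "z \<in> conj_face E l \<longleftrightarrow> (z, l) \<in> subgradient_rel E"
  by (simp add: conj_face_def)

text \<open>Here \<open>c\<close> is the conjugate value g*(l). On the face exposed by
  \<open>(l, -1)\<close> the height is determined by the base point,
  \<open>t = l \<bullet> z - c\<close>, so nothing is lost in the projection and membership becomes
  one affine test in \<open>E\<close>.\<close>

lemma conj_face_lift:
  fixes E :: "('b::euclidean_space \<times> real) set"
  assumes "convex E" "conj_face E l \<noteq> {}"
  obtains c where "\<And>y t. (y, t) \<in> E \<Longrightarrow> l \<bullet> y - t \<le> c"
    "E \<inter> {x. (l, -1) \<bullet> x = c} face_of E"
    "conj_face E l = fst ` (E \<inter> {x. (l, -1) \<bullet> x = c})"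
    "\<And>z. z \<in> conj_face E l \<longleftrightarrow> (z, l \<bullet> z - c) \<in> E"
proof -
  obtain z0 where "(z0, l) \<in> subgradient_rel E" using assms(2) by (auto simp: conj_face_def)
  then obtain r0 where r: "(z0, r0) \<in> E" "\<And>y t. (y, t) \<in> E \<Longrightarrow> l \<bullet> y - t \<le> l \<bullet> z0 - r0"
    using subgradient_relE by metis
  define c where "c = l \<bullet> z0 - r0"
  have le: "\<And>y t. (y, t) \<in> E \<Longrightarrow> l \<bullet> y - t \<le> c" using r(2) c_def by simp
  have char: "z \<in> conj_face E l \<longleftrightarrow> (z, l \<bullet> z - c) \<in> E" for z
  proof
    assume "z \<in> conj_face E l"
    then obtain s where s: "(z, s) \<in> E" "\<And>y t. (y, t) \<in> E \<Longrightarrow> l \<bullet> y - t \<le> l \<bullet> z - s"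
      using subgradient_relE unfolding mem_conj_face by metis
    have "s = l \<bullet> z - c" using s(2)[OF r(1)] le[OF s(1)] c_def by simp
    then show "(z, l \<bullet> z - c) \<in> E" using s(1) by simp
  next
    assume "(z, l \<bullet> z - c) \<in> E"
    then show "z \<in> conj_face E l"
      unfolding mem_conj_face subgradient_rel_def using le by (auto intro!: exI[of _ "l \<bullet> z - c"])
  qed
  have face: "E \<inter> {x. (l, -1) \<bullet> x = c} face_of E"
    using assms(1) le by (intro face_of_Int_supporting_hyperplane_le) (auto simp: inner_prod_def)
  have img: "conj_face E l = fst ` (E \<inter> {x. (l, -1) \<bullet> x = c})"
  proof (intro set_eqI iffI)
    fix z assume "z \<in> conj_face E l"
    then have "(z, l \<bullet> z - c) \<in> E \<inter> {x. (l, -1) \<bullet> x = c}" using char by simp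
    then show "z \<in> fst ` (E \<inter> {x. (l, -1) \<bullet> x = c})" by force
  next
    fix z assume "z \<in> fst ` (E \<inter> {x. (l, -1) \<bullet> x = c})"
    then obtain t where t: "(z, t) \<in> E" "l \<bullet> z - t = c" by auto
    then have "t = l \<bullet> z - c" by simp
    then show "z \<in> conj_face E l" using char t(1) by metis
  qed
  show ?thesis using that le face img char by blast
qed

lemma polyhedron_affine_vimage:
  fixes S :: "'c::euclidean_space set" and h :: "'b::euclidean_space \<Rightarrow> 'c"
  assumes "polyhedron S" "linear h"
  shows "polyhedron {z. h z + k \<in> S}"
proof -
  obtain H where H: "finite H" "S = \<Inter>H" "\<forall>X\<in>H. \<exists>a b. a \<noteq> 0 \<and> X = {x. a \<bullet> x \<le> b}"
    using assms(1) unfolding polyhedron_def by blast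
  have "{z. h z + k \<in> S} = \<Inter>((\<lambda>X. {z. h z + k \<in> X}) ` H)" using H(2) by auto
  moreover have "polyhedron {z. h z + k \<in> X}" if "X \<in> H" for X
  proof -
    from H(3)[rule_format, OF that] obtain a b where ab: "X = {x. a \<bullet> x \<le> b}" by blast
    have "{z. h z + k \<in> X} = {z. adjoint h a \<bullet> z \<le> b - a \<bullet> k}"
      using adjoint_works[OF assms(2)] unfolding ab
      by (simp add: inner_add_right inner_add_left inner_commute[of "adjoint h a"] inner_commute[of a] le_diff_eq)
    then show ?thesis by (simp add: polyhedron_halfspace_le)
  qed
  ultimately show ?thesis using H(1) by (auto intro!: polyhedron_Inter)
qed

lemma polyhedron_conj_face:
  fixes E :: "('b::euclidean_space \<times> real) set"
  assumes "polyhedron E"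
  shows "polyhedron (conj_face E l)"
proof (cases "conj_face E l = {}")
  case False
  then obtain c where c: "\<And>z. z \<in> conj_face E l \<longleftrightarrow> (z, l \<bullet> z - c) \<in> E"
    using conj_face_lift[OF polyhedron_imp_convex[OF assms]] by metis
  have "linear (\<lambda>z. (z, l \<bullet> z))" by (auto intro!: linearI simp: inner_add inner_scaleR)
  from polyhedron_affine_vimage[OF assms this, of "(0, - c)"]
  have "polyhedron {z. (z, l \<bullet> z - c) \<in> E}" by simp
  moreover have "conj_face E l = {z. (z, l \<bullet> z - c) \<in> E}" using c by blast
  ultimately show ?thesis by simp
qed auto

lemma finite_range_conj_face:
  fixes E :: "('b::euclidean_space \<times> real) set"
  assumes "polyhedron E"
  shows "finite (range (conj_face E))"
proof (rule finite_subset)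
  show "range (conj_face E) \<subseteq> insert {} ((`) fst ` {F. F face_of E})"
  proof
    fix A assume "A \<in> range (conj_face E)"
    then obtain l where A: "A = conj_face E l" by auto
    show "A \<in> insert {} ((`) fst ` {F. F face_of E})"
    proof (cases "A = {}")
      case False
      then obtain c where "E \<inter> {x. (l, -1) \<bullet> x = c} face_of E"
        "A = fst ` (E \<inter> {x. (l, -1) \<bullet> x = c})"
        using conj_face_lift[OF polyhedron_imp_convex[OF assms]] A by metis
      then show ?thesis by blast
    qed simp
  qed
  show "finite (insert {} ((`) fst ` {F. F face_of E}))"
    using finite_polyhedron_faces[OF assms] by simp
qed

text \<open>The height \<open>r\<close> above \<open>z\<close> is the same for all \<open>l\<close>;
  fixing it turns the existential into an intersection of closed half-spaces.\<close>

lemma closed_subgradients: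
  fixes E :: "('b::euclidean_space \<times> real) set"
  shows "closed {l. (z, l) \<in> subgradient_rel E}"
proof (cases "\<exists>l. (z, l) \<in> subgradient_rel E")
  case True
  then obtain l0 where "(z, l0) \<in> subgradient_rel E" by blast
  then obtain r where r: "(z, r) \<in> E" "\<And>y t. (y, t) \<in> E \<Longrightarrow> l0 \<bullet> y - t \<le> l0 \<bullet> z - r"
    using subgradient_relE by metis
  have "{l. (z, l) \<in> subgradient_rel E} = (\<Inter>(y, t)\<in>E. {l. l \<bullet> y - t \<le> l \<bullet> z - r})"
  proof (intro set_eqI iffI)
    fix l assume "l \<in> {l. (z, l) \<in> subgradient_rel E}"
    then obtain s where s: "(z, s) \<in> E" "\<And>y t. (y, t) \<in> E \<Longrightarrow> l \<bullet> y - t \<le> l \<bullet> z - s"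
      using subgradient_relE by blast
    have "s = r" using s(2)[OF r(1)] r(2)[OF s(1)] by simp
    then show "l \<in> (\<Inter>(y, t)\<in>E. {l. l \<bullet> y - t \<le> l \<bullet> z - r})" using s by auto
  next
    fix l assume "l \<in> (\<Inter>(y, t)\<in>E. {l. l \<bullet> y - t \<le> l \<bullet> z - r})"
    then show "l \<in> {l. (z, l) \<in> subgradient_rel E}"
      unfolding subgradient_rel_def using r(1) by auto
  qed
  moreover have "closed (\<Inter>(y, t)\<in>E. {l. l \<bullet> y - t \<le> l \<bullet> z - r})"
    by (auto intro!: closed_INT closed_Collect_le continuous_intros)
  ultimately show ?thesis by simp
qed simp

text \<open>Finiteness of the family of faces: the union of those faces that miss \<open>zb\<close>
  is closed, so a whole ball around \<open>zb\<close> avoids it, and any face reaching into that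
  ball must contain \<open>zb\<close>. The second inclusion is the same argument for subgradients.
  Together they let the two components of a nearby graph point be treated separately.\<close>

lemma subgradient_rel_local:
  fixes E :: "('b::euclidean_space \<times> real) set"
  assumes "polyhedron E"
  obtains e where "0 < e"
    "\<And>z l. \<lbrakk>(z, l) \<in> subgradient_rel E; dist z zb < e\<rbrakk> \<Longrightarrow> (zb, l) \<in> subgradient_rel E"
    "\<And>z l. \<lbrakk>(z, l) \<in> subgradient_rel E; dist l lb < e\<rbrakk> \<Longrightarrow> (z, lb) \<in> subgradient_rel E"
proof -
  define B1 where "B1 = \<Union> {A \<in> range (conj_face E). zb \<notin> A}"
  have "closed A" if "A \<in> range (conj_face E)" for A
    using that polyhedron_conj_face[OF assms] polyhedron_imp_closed by blast
  then have "closed B1"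
    unfolding B1_def using finite_range_conj_face[OF assms] by (intro closed_Union) auto
  moreover have "zb \<notin> B1" by (auto simp: B1_def)
  ultimately obtain e1 where e1: "e1 > 0" "ball zb e1 \<inter> B1 = {}"
    by (metis disjoint_iff mem_ball dist_commute separate_point_closed not_less)
  \<comment> \<open>\<open>D A\<close> consists of the common subgradients of the points of
    \<open>A\<close>, the counterpart of \<open>conj_face\<close> with the two variables
    exchanged.\<close>
  define D where "D A = {l. \<forall>z\<in>A. (z, l) \<in> subgradient_rel E}" for A
  define B2 where "B2 = \<Union> (D ` {A \<in> range (conj_face E). lb \<notin> D A})"
  have "closed (D A)" for A
  proof -
    have "D A = (\<Inter>z\<in>A. {l. (z, l) \<in> subgradient_rel E})" by (auto simp: D_def)
    then show ?thesis by (simp only:) (intro closed_INT ballI closed_subgradients)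
  qed
  then have "closed B2"
    unfolding B2_def using finite_range_conj_face[OF assms] by (intro closed_Union) auto
  moreover have "lb \<notin> B2" by (auto simp: B2_def)
  ultimately obtain e2 where e2: "e2 > 0" "ball lb e2 \<inter> B2 = {}"
    by (metis disjoint_iff mem_ball dist_commute separate_point_closed not_less)
  show ?thesis
  proof
    show "0 < min e1 e2" using e1 e2 by simp
  next
    fix z l assume zl: "(z, l) \<in> subgradient_rel E" "dist z zb < min e1 e2"
    have "z \<in> ball zb e1" using zl(2) by (simp add: dist_commute)
    then have "z \<notin> B1" using e1(2) by blast
    then have "zb \<in> conj_face E l" using zl(1) unfolding B1_def mem_conj_face[symmetric] by blast
    then show "(zb, l) \<in> subgradient_rel E" by (simp add: mem_conj_face)
  next
    fix z l assume zl: "(z, l) \<in> subgradient_rel E" "dist l lb < min e1 e2"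
    have "l \<in> ball lb e2" using zl(2) by (simp add: dist_commute)
    then have "l \<notin> B2" using e2(2) by blast
    moreover have "l \<in> D (conj_face E l)" by (simp add: D_def mem_conj_face)
    ultimately have "lb \<in> D (conj_face E l)" unfolding B2_def by blast
    then show "(z, lb) \<in> subgradient_rel E" using zl(1) unfolding D_def mem_conj_face[symmetric] by blast
  qed
qed

text \<open>The cross inequality gives one sign at every point of \<open>F\<close>. A segment from
  \<open>a\<close> to the relative interior point \<open>z\<close> can be prolonged beyond
  \<open>z\<close> inside \<open>F\<close>, and the inequality at the prolonged point gives the
  other sign.\<close>

lemma subgradient_orthogonal_rel_interior:
  fixes E :: "('b::euclidean_space \<times> real) set"
  assumes "convex F" "F \<subseteq> conj_face E l0" "z \<in> rel_interior F" "(z, l) \<in> subgradient_rel E" "a \<in> F"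
  shows "(l - l0) \<bullet> (a - z) = 0"
proof -
  have zF: "z \<in> F" using assms(3) rel_interior_subset by blast
  have le: "(l - l0) \<bullet> (a' - z) \<le> 0" if "a' \<in> F" for a'
    using subgradient_rel_cross[of z l0 E a' l] that assms(2,4) zF
    by (auto simp: mem_conj_face[symmetric] inner_commute)
  obtain e where e: "e > 1" "(1 - e) *\<^sub>R a + e *\<^sub>R z \<in> F"
    using convex_rel_interior_iff[of F z] assms zF by auto
  have "(1 - e) *\<^sub>R a + e *\<^sub>R z - z = (1 - e) *\<^sub>R (a - z)" by (simp add: algebra_simps)
  then have "(1 - e) * ((l - l0) \<bullet> (a - z)) \<le> 0" using le[OF e(2)] by simp
  then have "(l - l0) \<bullet> (a - z) \<ge> 0" using e(1) by (simp add: mult_le_0_iff)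
  then show ?thesis using le[OF assms(5)] by simp
qed

text \<open>The face \<open>F\<close> lifts to a face \<open>X\<close> of \<open>E\<close>, exposed
  by some \<open>a\<close>. Tilting \<open>(l0, -1)\<close> slightly towards \<open>a\<close> leaves
  exactly \<open>X\<close> as set of maximisers over \<open>E\<close>. This supplies the
  approximating multipliers for limiting normals.\<close>

lemma face_of_conj_face_realized:
  fixes E :: "('b::euclidean_space \<times> real) set"
  assumes "polyhedron E" "F face_of conj_face E l0" "F \<noteq> {}" "0 < e"
  obtains l where "dist l l0 < e" "conj_face E l = F"
proof -
  have cE: "convex E" using assms(1) polyhedron_imp_convex by blast
  have "F exposed_face_of conj_face E l0"
    using assms polyhedron_conj_face exposed_face_of_polyhedron by blast
  then obtain \<nu> b where nu: "conj_face E l0 \<subseteq> {x. \<nu> \<bullet> x \<le> b}" "F = conj_face E l0 \<inter> {x. \<nu> \<bullet> x = b}"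
    unfolding exposed_face_of_def by blast
  have ne: "conj_face E l0 \<noteq> {}" using nu(2) assms(3) by blast
  obtain c where c: "\<And>y t. (y, t) \<in> E \<Longrightarrow> l0 \<bullet> y - t \<le> c"
    "E \<inter> {x. (l0, -1) \<bullet> x = c} face_of E"
    "conj_face E l0 = fst ` (E \<inter> {x. (l0, -1) \<bullet> x = c})"
    "\<And>z. z \<in> conj_face E l0 \<longleftrightarrow> (z, l0 \<bullet> z - c) \<in> E"
    using conj_face_lift[OF cE ne] by metis
  define X0 where "X0 = E \<inter> {x. (l0, -1) \<bullet> x = c}"
  define X where "X = X0 \<inter> {x. (\<nu>, 0) \<bullet> x = b}"
  have "X face_of X0"
    unfolding X_def
  proof (rule face_of_Int_supporting_hyperplane_le)
    show "convex X0" unfolding X0_def using c(2) face_of_imp_convex by blast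
    fix x assume "x \<in> X0"
    then have "fst x \<in> conj_face E l0" unfolding c(3) X0_def by blast
    then show "(\<nu>, 0) \<bullet> x \<le> b" using nu(1) by (auto simp: inner_prod_def)
  qed
  \<comment> \<open>The functional \<open>\<nu>\<close> is controlled only on
    \<open>conj_face E l0\<close>. Transitivity of faces replaces it by a functional
    \<open>a\<close> that is bounded on all of \<open>E\<close> and attains its bound exactly on
    \<open>X\<close>, so that the tilt works for every step length \<open>s\<close> with
    \<open>s * \<beta> < 1\<close>.\<close>
  then have "X face_of E" using face_of_trans c(2) X0_def by blast
  then have "X exposed_face_of E" using exposed_face_of_polyhedron[OF assms(1)] by blast
  then obtain a d where ad: "E \<subseteq> {x. a \<bullet> x \<le> d}" "X = E \<inter> {x. a \<bullet> x = d}"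
    unfolding exposed_face_of_def by blast
  obtain \<mu> \<beta> where a: "a = (\<mu>, \<beta>)" by (cases a)
  have XF: "(z, t) \<in> X \<longleftrightarrow> z \<in> F \<and> t = l0 \<bullet> z - c" for z t
    using c(4)[of z] unfolding X_def X0_def nu(2) by auto
  \<comment> \<open>The tilted functional \<open>(l0, -1) + s *\<^sub>R (\<mu>, \<beta>)\<close>
    equals \<open>(1 - s * \<beta>)\<close> times \<open>(ls s, -1)\<close>: dividing by this factor
    restores the last coordinate -1.\<close>
  define ls where "ls s = (1 / (1 - s * \<beta>)) *\<^sub>R (l0 + s *\<^sub>R \<mu>)" for s
  have "(ls \<longlongrightarrow> (1 / (1 - 0 * \<beta>)) *\<^sub>R (l0 + 0 *\<^sub>R \<mu>)) (at_right 0)"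
    unfolding ls_def by (intro tendsto_intros) auto
  then have "(ls \<longlongrightarrow> l0) (at_right 0)" by simp
  then have ev1: "eventually (\<lambda>s. dist (ls s) l0 < e) (at_right 0)"
    using assms(4) tendstoD by blast
  have "((\<lambda>s. s * \<beta>) \<longlongrightarrow> 0 * \<beta>) (at_right 0)" by (intro tendsto_intros)
  then have ev2: "eventually (\<lambda>s. s * \<beta> < 1) (at_right 0)"
    by (rule order_tendstoD) simp
  have "eventually (\<lambda>s::real. 0 < s) (at_right 0)" by (simp add: eventually_at_right_less)
  with ev1 ev2 have "eventually (\<lambda>s. dist (ls s) l0 < e \<and> s * \<beta> < 1 \<and> 0 < s) (at_right 0)"
    by (simp add: eventually_conj)
  then obtain s where s: "dist (ls s) l0 < e" "s * \<beta> < 1" "0 < s"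
    using eventually_happens trivial_limit_at_right_real by blast
  have val: "(1 - s * \<beta>) * (ls s \<bullet> y - t) = (l0 \<bullet> y - t) + s * (a \<bullet> (y, t))" for y t
  proof -
    have "(1 - s * \<beta>) * (ls s \<bullet> y) = (l0 + s *\<^sub>R \<mu>) \<bullet> y" unfolding ls_def using s(2) by simp
    then show ?thesis by (simp add: a algebra_simps inner_add)
  qed
  have le: "(l0 \<bullet> y - t) + s * (a \<bullet> (y, t)) \<le> c + s * d" if "(y, t) \<in> E" for y t
    using c(1)[OF that] ad(1) that s(3) by (auto intro!: add_mono mult_left_mono)
  obtain f where "f \<in> F" using assms(3) by blast
  define fx where "fx = l0 \<bullet> f - c"
  have f: "(f, fx) \<in> X" using \<open>f \<in> F\<close> XF fx_def by simp
  have onX: "(l0 \<bullet> y - t) + s * (a \<bullet> (y, t)) = c + s * d" if "(y, t) \<in> X" for y t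
    using that ad(2) XF by auto
  have "conj_face E (ls s) = F"
  proof (intro set_eqI iffI)
    fix z assume "z \<in> conj_face E (ls s)"
    then obtain r where r: "(z, r) \<in> E" "\<And>y t. (y, t) \<in> E \<Longrightarrow> ls s \<bullet> y - t \<le> ls s \<bullet> z - r"
      using subgradient_relE unfolding mem_conj_face by metis
    have "(f, fx) \<in> E" using f ad(2) by blast
    then have "(1 - s * \<beta>) * (ls s \<bullet> f - fx) \<le> (1 - s * \<beta>) * (ls s \<bullet> z - r)"
      using r(2) s(2) by (intro mult_left_mono) auto
    then have "c + s * d \<le> (l0 \<bullet> z - r) + s * (a \<bullet> (z, r))"
      unfolding val using onX[OF f] by simp
    moreover have "l0 \<bullet> z - r \<le> c" using c(1) r(1) by blast
    moreover have "s * (a \<bullet> (z, r)) \<le> s * d" using ad(1) r(1) s(3) by (intro mult_left_mono) auto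
    ultimately have "s * (a \<bullet> (z, r)) = s * d" by linarith
    then have "a \<bullet> (z, r) = d" using s(3) by simp
    then have "(z, r) \<in> X" using r(1) ad(2) by blast
    then show "z \<in> F" using XF by simp
  next
    fix z assume "z \<in> F"
    define r where "r = l0 \<bullet> z - c"
    have zX: "(z, r) \<in> X" using XF \<open>z \<in> F\<close> r_def by simp
    show "z \<in> conj_face E (ls s)"
      unfolding mem_conj_face subgradient_rel_def
    proof (clarify, intro exI conjI allI impI)
      show "(z, r) \<in> E" using zX ad(2) by blast
      fix y t assume yt: "(y, t) \<in> E"
      have "(1 - s * \<beta>) * (ls s \<bullet> y - t) \<le> (1 - s * \<beta>) * (ls s \<bullet> z - r)"
        unfolding val using le[OF yt] onX[OF zX] by simp
      then show "ls s \<bullet> y - t \<le> ls s \<bullet> z - r" using s(2) by simp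
    qed
  qed
  then show ?thesis using that s(1) by blast
qed

section \<open>Limiting normals along faces\<close>

text \<open>By \<open>subgradient_rel_local\<close>, a graph point close to \<open>(z, l)\<close>
  has its first component in \<open>conj_face E l\<close> and its second among the subgradients at
  \<open>z\<close>. Hence \<open>p\<close> is tested only against the face, and \<open>q\<close>, a
  feasible direction of the face, only against subgradient directions, where the cross inequality
  applies.\<close>

lemma frechet_normal_subgradient_rel:
  fixes E :: "('b::euclidean_space \<times> real) set"
  assumes "polyhedron E" "(z, l) \<in> subgradient_rel E"
    and p: "\<And>z'. z' \<in> conj_face E l \<Longrightarrow> p \<bullet> (z' - z) \<le> 0"
    and q: "0 < e" "z + e *\<^sub>R q \<in> conj_face E l"
  shows "(p, q) \<in> frechet_normal (subgradient_rel E) (z, l)"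
  unfolding frechet_normal_def
proof (clarify)
  fix d1 d2 assume "(d1, d2) \<in> tangent_cone (subgradient_rel E) (z, l)"
  then obtain t dd where t: "\<And>k. 0 < t k" "t \<longlonglongrightarrow> (0::real)" "dd \<longlonglongrightarrow> (d1, d2)"
    and mem: "\<And>k. (z, l) + t k *\<^sub>R dd k \<in> subgradient_rel E"
    unfolding tangent_cone_def by blast
  have f: "(\<lambda>k. fst (dd k)) \<longlonglongrightarrow> d1" "(\<lambda>k. snd (dd k)) \<longlonglongrightarrow> d2"
    using tendsto_fst[OF t(3)] tendsto_snd[OF t(3)] by simp_all
  obtain \<epsilon> where eps: "0 < \<epsilon>"
    "\<And>z' l'. \<lbrakk>(z', l') \<in> subgradient_rel E; dist z' z < \<epsilon>\<rbrakk> \<Longrightarrow> (z, l') \<in> subgradient_rel E"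
    "\<And>z' l'. \<lbrakk>(z', l') \<in> subgradient_rel E; dist l' l < \<epsilon>\<rbrakk> \<Longrightarrow> (z', l) \<in> subgradient_rel E"
    using subgradient_rel_local[OF assms(1), of z l] by metis
  have "(\<lambda>k. z + t k *\<^sub>R fst (dd k)) \<longlonglongrightarrow> z + 0 *\<^sub>R d1" by (intro tendsto_intros t f)
  then have e1: "\<forall>\<^sub>F k in sequentially. dist (z + t k *\<^sub>R fst (dd k)) z < \<epsilon>"
    using eps(1) by (intro tendstoD) auto
  have "(\<lambda>k. l + t k *\<^sub>R snd (dd k)) \<longlonglongrightarrow> l + 0 *\<^sub>R d2" by (intro tendsto_intros t f)
  then have e2: "\<forall>\<^sub>F k in sequentially. dist (l + t k *\<^sub>R snd (dd k)) l < \<epsilon>"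
    using eps(1) by (intro tendstoD) auto
  have mem': "(z + t k *\<^sub>R fst (dd k), l + t k *\<^sub>R snd (dd k)) \<in> subgradient_rel E" for k
    using mem[of k] by (simp add: plus_prod_def scaleR_prod_def)
  have "\<forall>\<^sub>F k in sequentially. p \<bullet> fst (dd k) + q \<bullet> snd (dd k) \<le> 0"
    using e1 e2
  proof eventually_elim
    case (elim k)
    have "(z + t k *\<^sub>R fst (dd k), l) \<in> subgradient_rel E" using eps(3)[OF mem' elim(2)] .
    then have "p \<bullet> (t k *\<^sub>R fst (dd k)) \<le> 0" using p[of "z + t k *\<^sub>R fst (dd k)"] by (simp add: mem_conj_face)
    then have 1: "p \<bullet> fst (dd k) \<le> 0" using t(1)[of k] by (simp add: mult_le_0_iff)
    have "(z, l + t k *\<^sub>R snd (dd k)) \<in> subgradient_rel E" using eps(2)[OF mem' elim(1)] .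
    from subgradient_rel_cross[OF assms(2) q(2)[unfolded mem_conj_face] this]
    have "e * (t k * (q \<bullet> snd (dd k))) \<le> 0" by (simp add: mult.left_commute)
    then have "q \<bullet> snd (dd k) \<le> 0" using t(1)[of k] q(1) by (simp add: mult_le_0_iff)
    with 1 show ?case by simp
  qed
  moreover have "(\<lambda>k. p \<bullet> fst (dd k) + q \<bullet> snd (dd k)) \<longlonglongrightarrow> p \<bullet> d1 + q \<bullet> d2"
    by (intro tendsto_intros f)
  ultimately have "p \<bullet> d1 + q \<bullet> d2 \<le> 0" using tendsto_upperbound by (metis sequentially_bot)
  then show "(p, q) \<bullet> (d1, d2) \<le> 0" by simp
qed

text \<open>Multipliers \<open>ls k\<close> tending to \<open>lb\<close> with
  \<open>conj_face E (ls k) = F\<close> turn the constant pair \<open>(p, q)\<close> into a Frechet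
  normal at each \<open>(zs k, ls k)\<close>. The choice of \<open>zs\<close>, in the relative
  interior of \<open>F\<close> or of a facet, decides which pairs result.\<close>

lemma limiting_normal_subgradient_rel:
  fixes E :: "('b::euclidean_space \<times> real) set"
  assumes "polyhedron E" "F face_of conj_face E lb"
    and zs: "\<And>k. zs k \<in> F" "zs \<longlonglongrightarrow> zb"
    and p: "\<And>z k. z \<in> F \<Longrightarrow> p \<bullet> (z - zs k) \<le> 0"
    and q: "\<And>k. \<exists>e>0. zs k + e *\<^sub>R q \<in> F"
  shows "(p, q) \<in> limiting_normal (subgradient_rel E) (zb, lb)"
proof -
  have "F \<noteq> {}" using zs by blast
  have "\<exists>l. dist l lb < 1 / real (Suc k) \<and> conj_face E l = F" for k
    using face_of_conj_face_realized[OF assms(1,2) \<open>F \<noteq> {}\<close>, of "1 / real (Suc k)"] by (metis zero_less_divide_1_iff of_nat_0_less_iff zero_less_Suc)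
  then obtain ls where ls: "\<And>k. dist (ls k) lb < 1 / real (Suc k)" "\<And>k. conj_face E (ls k) = F"
    by metis
  have "(\<lambda>k. dist (ls k) lb) \<longlonglongrightarrow> 0"
  proof (rule tendsto_sandwich[OF _ _ tendsto_const lim_1_over_n[THEN filterlim_compose[OF _ filterlim_Suc]]])
    show "\<forall>\<^sub>F n in sequentially. dist (ls n) lb \<le> 1 / of_nat (Suc n)"
      using ls(1) by (auto intro!: always_eventually less_imp_le)
  qed auto
  then have "ls \<longlonglongrightarrow> lb" using tendsto_dist_iff by blast
  then have lim: "(\<lambda>k. (zs k, ls k)) \<longlonglongrightarrow> (zb, lb)" using zs(2) by (intro tendsto_Pair)
  have mem: "(zs k, ls k) \<in> subgradient_rel E" for k
    using zs(1)[of k] ls(2)[of k] by (simp add: mem_conj_face[symmetric])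
  have "(p, q) \<in> frechet_normal (subgradient_rel E) (zs k, ls k)" for k
  proof -
    obtain e where e: "0 < e" "zs k + e *\<^sub>R q \<in> F" using q by blast
    show ?thesis
      by (rule frechet_normal_subgradient_rel[OF assms(1) mem _ e(1)]) (use e(2) ls(2) p in auto)
  qed
  then show ?thesis
    unfolding limiting_normal_def using mem lim
    by (intro CollectI exI[of _ "\<lambda>k. (zs k, ls k)"] exI[of _ "\<lambda>_. (p, q)"]) auto
qed

lemma rel_interior_sequence:
  fixes F :: "'b::euclidean_space set"
  assumes "convex F" "a \<in> F"
  obtains zs where "\<And>k::nat. zs k \<in> rel_interior F" "zs \<longlonglongrightarrow> a"
proof -
  obtain c where c: "c \<in> rel_interior F" using assms rel_interior_eq_empty by blast
  define zs where "zs k = a - (1 / real (Suc k)) *\<^sub>R (a - c)" for k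
  have "zs k \<in> rel_interior F" for k
    unfolding zs_def using assms c by (intro rel_interior_convex_shrink) auto
  moreover have "zs \<longlonglongrightarrow> a - 0 *\<^sub>R (a - c)"
    unfolding zs_def by (intro tendsto_intros lim_1_over_n[THEN filterlim_compose[OF _ filterlim_Suc]])
  ultimately show ?thesis using that[of zs] by simp
qed

lemma rel_interior_move:
  fixes F :: "'b::euclidean_space set"
  assumes "convex F" "z \<in> rel_interior F" "a \<in> F" "s \<in> span ((\<lambda>x. x - a) ` F)"
  shows "\<exists>e>0. z + e *\<^sub>R s \<in> F"
proof -
  have zF: "z \<in> F" using assms(2) rel_interior_subset by blast
  have "z - a \<in> span ((\<lambda>x. x - a) ` F)" using zF by (simp add: span_base)
  then have "z - a - s \<in> span ((\<lambda>x. x - a) ` F)" using assms(4) span_diff by blast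
  then have "z - a - s \<in> (\<lambda>x. x - a) ` (affine hull F)" using diffs_affine_hull_span[OF assms(3)] by simp
  then have "z - s \<in> affine hull F" by (auto simp: algebra_simps)
  then obtain e where "e > 1" "(1 - e) *\<^sub>R (z - s) + e *\<^sub>R z \<in> F"
    using convex_rel_interior_iff2[of F z] assms zF by auto
  moreover have "(1 - e) *\<^sub>R (z - s) + e *\<^sub>R z = z + (e - 1) *\<^sub>R s" by (simp add: algebra_simps)
  ultimately show ?thesis by (auto intro!: exI[of _ "e - 1"])
qed

text \<open>At relative interior points of \<open>F\<close> every direction of the span is feasible.
  Approaching \<open>zb\<close> through such points yields the full product of the orthogonal
  complement of the span with the span, even if \<open>zb\<close> itself is on the relative
  boundary.\<close>

lemma limiting_normal_face_span:
  fixes E :: "('b::euclidean_space \<times> real) set"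
  assumes "polyhedron E" "F face_of conj_face E lb" "zb \<in> F"
    and p: "\<And>s. s \<in> span ((\<lambda>x. x - zb) ` F) \<Longrightarrow> p \<bullet> s = 0"
    and q: "q \<in> span ((\<lambda>x. x - zb) ` F)"
  shows "(p, q) \<in> limiting_normal (subgradient_rel E) (zb, lb)"
proof -
  have cF: "convex F" using assms(2) face_of_imp_convex by blast
  obtain zs where zs: "\<And>k. zs k \<in> rel_interior F" "zs \<longlonglongrightarrow> zb"
    using rel_interior_sequence[OF cF assms(3)] by metis
  have zF: "zs k \<in> F" for k using zs(1) rel_interior_subset by blast
  show ?thesis
  proof (rule limiting_normal_subgradient_rel[OF assms(1,2) zF zs(2)])
    fix z k assume "z \<in> F"
    then have "p \<bullet> (z - zb) = 0" "p \<bullet> (zs k - zb) = 0" using zF by (auto intro!: p span_base)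
    then show "p \<bullet> (z - zs k) \<le> 0" by (simp add: inner_diff_right)
  next
    fix k show "\<exists>e>0. zs k + e *\<^sub>R q \<in> F" using rel_interior_move[OF cF zs(1) assms(3) q] .
  qed
qed

text \<open>The inward normal of the facet, taken inside the direction space of \<open>F\<close>; a
  dimension count identifies its kernel there with the direction space of the facet.\<close>

lemma facet_normal:
  fixes F :: "'b::euclidean_space set"
  assumes "polyhedron F" "F' facet_of F" "a \<in> F'"
  obtains n where "n \<in> span ((\<lambda>x. x - a) ` F)" "n \<noteq> 0" "\<And>x. x \<in> F \<Longrightarrow> 0 \<le> n \<bullet> (x - a)"
    "\<And>v. v \<in> span ((\<lambda>x. x - a) ` F) \<Longrightarrow> v \<in> span ((\<lambda>x. x - a) ` F') \<longleftrightarrow> n \<bullet> v = 0"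
proof -
  define S where "S = span ((\<lambda>x. x - a) ` F)"
  define S' where "S' = span ((\<lambda>x. x - a) ` F')"
  have face: "F' face_of F" and sub: "F' \<subseteq> F" and dimF: "aff_dim F' = aff_dim F - 1"
    using assms(2) facet_of_imp_face_of facet_of_imp_subset unfolding facet_of_def by blast+
  obtain \<nu> b where nu: "F \<subseteq> {x. \<nu> \<bullet> x \<le> b}" "F' = F \<inter> {x. \<nu> \<bullet> x = b}"
    using face exposed_face_of_polyhedron[OF assms(1)] unfolding exposed_face_of_def by metis
  have "F' \<noteq> F" using dimF by auto
  then obtain f where f: "f \<in> F" "f \<notin> F'" using sub by blast
  \<comment> \<open>\<open>n\<close> is the orthogonal projection onto \<open>S\<close> of
    \<open>- \<nu>\<close>; the sign makes it point into \<open>F\<close>, and on \<open>S\<close>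
    it acts like \<open>- \<nu>\<close>.\<close>
  obtain n m where nm: "n \<in> S" "\<And>w. w \<in> S \<Longrightarrow> orthogonal m w" "- \<nu> = n + m"
    using orthogonal_subspace_decomp_exists[of "(\<lambda>x. x - a) ` F" "- \<nu>"] unfolding S_def by metis
  have n: "n \<bullet> v = - (\<nu> \<bullet> v)" if "v \<in> S" for v
  proof -
    have "m \<bullet> v = 0" using nm(2)[OF that] by (simp add: orthogonal_def)
    then have "(- \<nu>) \<bullet> v = n \<bullet> v" unfolding nm(3) by (simp add: inner_add)
    then show ?thesis by simp
  qed
  have mS: "x - a \<in> S" if "x \<in> F" for x using that by (simp add: S_def span_base)
  have va: "\<nu> \<bullet> a = b" using assms(3) nu(2) by blast
  have nF: "n \<bullet> (x - a) = b - \<nu> \<bullet> x" if "x \<in> F" for x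
    using n[OF mS[OF that]] va by (simp add: inner_diff_right)
  have nf: "0 < n \<bullet> (f - a)" using nF[OF f(1)] f nu by auto
  have SS': "S' \<subseteq> S" unfolding S_def S'_def using sub by (intro span_mono image_mono)
  define K where "K = S \<inter> {v. n \<bullet> v = 0}"
  have subK: "subspace K" unfolding K_def S_def
    by (intro subspace_inter subspace_span subspace_hyperplane)
  have "S' \<subseteq> K" unfolding S'_def
  proof (rule span_minimal[OF _ subK])
    show "(\<lambda>x. x - a) ` F' \<subseteq> K" using mS sub nF nu(2) by (auto simp: K_def)
  qed
  have "aff_dim F = int (dim S)" "aff_dim F' = int (dim S')"
    unfolding S_def S'_def dim_span using sub assms(3)
    by (auto intro!: aff_dim_eq_dim_subtract hull_inc)
  then have dims: "dim S = dim S' + 1" using dimF by simp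
  \<comment> \<open>\<open>S'\<close> has codimension one in \<open>S\<close> and lies in the proper
    subspace \<open>K\<close>, so the two coincide.\<close>
  have "K \<subset> S" using nf mS[OF f(1)] unfolding K_def by force
  then have "dim K < dim S" using subK
    by (intro dim_psubset) (metis S_def span_eq_iff span_span)
  then have "dim K \<le> dim S'" using dims by simp
  then have "S' = K" using \<open>S' \<subseteq> K\<close> subK by (intro subspace_dim_equal) (auto simp: S'_def)
  show ?thesis
  proof
    show "n \<in> span ((\<lambda>x. x - a) ` F)" using nm(1) S_def by simp
    show "n \<noteq> 0" using nf by auto
    show "0 \<le> n \<bullet> (x - a)" if "x \<in> F" for x using nF[OF that] nu(1) that by auto
    show "v \<in> span ((\<lambda>x. x - a) ` F') \<longleftrightarrow> n \<bullet> v = 0" if "v \<in> span ((\<lambda>x. x - a) ` F)" for v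
      using that \<open>S' = K\<close> unfolding K_def S_def S'_def by blast
  qed
qed

text \<open>A strictly inward direction splits into a part tangent to the facet, feasible because
  \<open>z\<close> is in its relative interior, and a positive multiple of \<open>f - z\<close>,
  feasible because \<open>f\<close> is in \<open>F\<close>. Convexity combines the two.\<close>

lemma facet_move_inward:
  fixes F :: "'b::euclidean_space set"
  assumes "convex F" "convex F'" "F' \<subseteq> F" "a \<in> F'" "z \<in> rel_interior F'"
    and n: "\<And>v. v \<in> span ((\<lambda>x. x - a) ` F) \<Longrightarrow> v \<in> span ((\<lambda>x. x - a) ` F') \<longleftrightarrow> n \<bullet> v = 0"
    and f: "f \<in> F" "0 < n \<bullet> (f - a)"
    and q: "q \<in> span ((\<lambda>x. x - a) ` F)" "0 < n \<bullet> q"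
  shows "\<exists>e>0. z + e *\<^sub>R q \<in> F"
proof -
  have zF': "z \<in> F'" using assms(5) rel_interior_subset by blast
  have mem: "x - a \<in> span ((\<lambda>x. x - a) ` F)" if "x \<in> F" for x using that by (simp add: span_base)
  have nz: "n \<bullet> (z - a) = 0" using n[OF mem] zF' assms(3) by (auto intro: span_base)
  \<comment> \<open>Chosen so that \<open>s = q - t *\<^sub>R (f - z)\<close> has no component along
    \<open>n\<close>, hence lies in the direction space of the facet.\<close>
  define t where "t = (n \<bullet> q) / (n \<bullet> (f - a))"
  have t: "0 < t" "t * (n \<bullet> (f - a)) = n \<bullet> q" using q f by (auto simp: t_def)
  define s where "s = q - t *\<^sub>R (f - z)"
  have eq: "f - z = (f - a) - (z - a)" by simp
  have fz: "f - z \<in> span ((\<lambda>x. x - a) ` F)" unfolding eq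
    by (rule span_diff) (use mem f(1) zF' assms(3) in blast)+
  have nfz: "n \<bullet> (f - z) = n \<bullet> (f - a)" unfolding eq using nz by (simp only: inner_diff_right)
  have "s \<in> span ((\<lambda>x. x - a) ` F)" unfolding s_def by (rule span_diff[OF q(1) span_scale[OF fz]])
  moreover have "n \<bullet> s = 0"
    unfolding s_def inner_diff_right[of n q] inner_scaleR_right nfz using t(2) by simp
  ultimately have "s \<in> span ((\<lambda>x. x - a) ` F')" using n by blast
  then obtain e1 where e1: "0 < e1" "z + e1 *\<^sub>R s \<in> F'"
    using rel_interior_move[OF assms(2,5,4)] by blast
  define e where "e = min e1 (1 / t)"
  have e: "0 < e" "e \<le> e1" "e * t \<le> 1"
    using e1 t(1) by (auto simp: e_def min_def field_simps)
  have A: "z + e *\<^sub>R s \<in> F"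
  proof -
    have "(1 - e / e1) *\<^sub>R z + (e / e1) *\<^sub>R (z + e1 *\<^sub>R s) \<in> F"
      using e e1 zF' assms(1,3) by (intro convexD_alt) auto
    moreover have "(1 - e / e1) *\<^sub>R z + (e / e1) *\<^sub>R (z + e1 *\<^sub>R s) = z + e *\<^sub>R s"
      using e1 by (simp add: algebra_simps)
    ultimately show ?thesis by simp
  qed
  have B: "z + (e * t) *\<^sub>R (f - z) \<in> F"
  proof -
    have "(1 - e * t) *\<^sub>R z + (e * t) *\<^sub>R f \<in> F"
      using e t f(1) zF' assms(1,3) by (intro convexD_alt) auto
    then show ?thesis by (simp add: algebra_simps)
  qed
  \<comment> \<open>The midpoint of the two moves is a move along \<open>q\<close> of half the
    length.\<close>
  have "(1 - 1/2) *\<^sub>R (z + e *\<^sub>R s) + (1/2) *\<^sub>R (z + (e * t) *\<^sub>R (f - z)) \<in> F"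
    using A B assms(1) by (intro convexD_alt) auto
  moreover have "(1 - 1/2) *\<^sub>R (z + e *\<^sub>R s) + (1/2) *\<^sub>R (z + (e * t) *\<^sub>R (f - z)) = z + (e/2) *\<^sub>R q"
  proof -
    have "(1 - 1/2) *\<^sub>R (z + e *\<^sub>R s) + (1/2) *\<^sub>R (z + (e * t) *\<^sub>R (f - z))
        = (1/2 + 1/2) *\<^sub>R z + (e/2) *\<^sub>R (s + t *\<^sub>R (f - z))"
      unfolding scaleR_add_left by (simp add: scaleR_add_right)
    then show ?thesis by (simp add: s_def)
  qed
  ultimately show ?thesis using e(1) by (intro exI[of _ "e/2"]) auto
qed

text \<open>Base points in the relative interior of \<open>F'\<close>, with multipliers whose face
  is the larger \<open>F\<close>: there the outward functional \<open>- n\<close> is normal to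
  \<open>F\<close> and every strictly inward \<open>q\<close> is feasible. These pairs decide the
  sign in the climb along facets.\<close>

lemma limiting_normal_facet:
  fixes E :: "('b::euclidean_space \<times> real) set"
  assumes "polyhedron E" "F face_of conj_face E lb" "F' facet_of F" "zb \<in> F'"
    and n: "n \<in> span ((\<lambda>x. x - zb) ` F)" "n \<noteq> 0" "\<And>x. x \<in> F \<Longrightarrow> 0 \<le> n \<bullet> (x - zb)"
      "\<And>v. v \<in> span ((\<lambda>x. x - zb) ` F) \<Longrightarrow> v \<in> span ((\<lambda>x. x - zb) ` F') \<longleftrightarrow> n \<bullet> v = 0"
    and p: "\<And>s. s \<in> span ((\<lambda>x. x - zb) ` F) \<Longrightarrow> p \<bullet> s = - (n \<bullet> s)"
    and q: "q \<in> span ((\<lambda>x. x - zb) ` F)" "0 < n \<bullet> q"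
  shows "(p, q) \<in> limiting_normal (subgradient_rel E) (zb, lb)"
proof -
  have cF: "convex F" using assms(2) face_of_imp_convex by blast
  have cF': "convex F'" using assms(3) facet_of_imp_face_of face_of_imp_convex by blast
  have sub: "F' \<subseteq> F" using assms(3) facet_of_imp_subset by blast
  have "\<exists>f\<in>F. 0 < n \<bullet> (f - zb)"
  proof (rule ccontr)
    assume "\<not> ?thesis"
    then have "n \<bullet> (f - zb) = 0" if "f \<in> F" for f using n(3)[OF that] that by force
    then have "(\<lambda>x. x - zb) ` F \<subseteq> {v. n \<bullet> v = 0}" by auto
    then have "span ((\<lambda>x. x - zb) ` F) \<subseteq> {v. n \<bullet> v = 0}"
      by (intro span_minimal subspace_hyperplane)
    then show False using n(1,2) by auto
  qed
  then obtain f where f: "f \<in> F" "0 < n \<bullet> (f - zb)" by blast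
  obtain zs where zs: "\<And>k. zs k \<in> rel_interior F'" "zs \<longlonglongrightarrow> zb"
    using rel_interior_sequence[OF cF' assms(4)] by metis
  have zF': "zs k \<in> F'" for k using zs(1) rel_interior_subset by blast
  show ?thesis
  proof (rule limiting_normal_subgradient_rel[OF assms(1,2) _ zs(2)])
    show "zs k \<in> F" for k using zF' sub by blast
  next
    fix z k assume z: "z \<in> F"
    have zk: "zs k - zb \<in> span ((\<lambda>x. x - zb) ` F)" using zF' sub by (auto intro: span_base)
    have "n \<bullet> (zs k - zb) = 0" using n(4)[OF zk] zF' by (auto intro: span_base)
    then have "p \<bullet> (zs k - zb) = 0" using p[OF zk] by simp
    moreover have "p \<bullet> (z - zb) \<le> 0" using p[OF span_base, of "z - zb"] n(3)[OF z] z by auto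
    ultimately show "p \<bullet> (z - zs k) \<le> 0" by (simp add: inner_diff_right)
  next
    fix k show "\<exists>e>0. zs k + e *\<^sub>R q \<in> F"
      by (rule facet_move_inward[OF cF cF' sub assms(4) zs(1) n(4) f q])
  qed
qed

section \<open>The coderivative condition on faces\<close>

lemma linear_orthogonal_projection_exists:
  fixes S :: "'b::euclidean_space set"
  assumes "subspace S"
  obtains P where "linear P" "\<And>v. P v \<in> S" "\<And>v s. s \<in> S \<Longrightarrow> (v - P v) \<bullet> s = 0"
proof -
  obtain B where B: "B \<subseteq> S" "pairwise orthogonal B" "\<And>x. x \<in> B \<Longrightarrow> norm x = 1" "independent B"
    "span B = S"
    using orthonormal_basis_subspace[OF assms] by metis
  have fin: "finite B" using B(4) independent_imp_finite by blast
  define P where "P v = (\<Sum>b\<in>B. (v \<bullet> b) *\<^sub>R b)" for v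
  have lin: "linear P"
    unfolding P_def by (auto intro!: linearI simp: inner_add scaleR_add_left sum.distrib scaleR_sum_right)
  have PS: "P v \<in> S" for v
    unfolding P_def B(5)[symmetric] by (intro span_sum span_scale) (rule span_base)
  have Pb: "P v \<bullet> b = v \<bullet> b" if "b \<in> B" for v b
  proof -
    have "P v \<bullet> b = (\<Sum>c\<in>B. (v \<bullet> c) * (c \<bullet> b))" by (simp add: P_def inner_sum_left)
    also have "\<dots> = (\<Sum>c\<in>B. if c = b then v \<bullet> b else 0)"
    proof (rule sum.cong)
      fix c assume "c \<in> B"
      show "(v \<bullet> c) * (c \<bullet> b) = (if c = b then v \<bullet> b else 0)"
        using B(2) B(3)[OF that] \<open>c \<in> B\<close> that
        by (auto simp: pairwise_def orthogonal_def dot_square_norm)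
    qed simp
    also have "\<dots> = v \<bullet> b" using fin that by simp
    finally show ?thesis .
  qed
  have "(v - P v) \<bullet> s = 0" if "s \<in> S" for v s
  proof -
    have "s \<in> span B" using that B(5) by simp
    moreover have "B \<subseteq> {s. (v - P v) \<bullet> s = 0}" using Pb by (auto simp: inner_diff_left)
    ultimately show ?thesis using span_minimal[OF _ subspace_hyperplane] by blast
  qed
  then show ?thesis using that lin PS by blast
qed

text \<open>A Fredholm argument: the conditions \<open>J y \<in> S\<close> and
  \<open>P y' = n\<close> are packed into one equation in 'b, which makes the system square, so that
  the injectivity assumed in \<open>inj\<close> implies surjectivity.\<close>

lemma reduced_system_solvable:
  fixes H :: "'a::euclidean_space \<Rightarrow> 'a" and J :: "'a \<Rightarrow> 'b::euclidean_space"
  assumes "linear H" "linear J" "subspace S" "n \<in> S"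
    and inj: "\<And>w w'. \<lbrakk>H w + adjoint J w' = 0; J w \<in> S; \<And>s. s \<in> S \<Longrightarrow> w' \<bullet> s = 0\<rbrakk> \<Longrightarrow> w = 0 \<and> w' = 0"
  obtains y y' where "H y + adjoint J y' = 0" "J y \<in> S" "\<And>s. s \<in> S \<Longrightarrow> y' \<bullet> s = n \<bullet> s"
proof -
  obtain P where P: "linear P" "\<And>v. P v \<in> S" "\<And>v s. s \<in> S \<Longrightarrow> (v - P v) \<bullet> s = 0"
    using linear_orthogonal_projection_exists[OF assms(3)] by metis
  have split: "J w - P (J w) = 0 \<and> P w' - m = 0" if "(J w - P (J w)) + P w' = m" "m \<in> S" for w w' m
  proof -
    have mem: "P w' - m \<in> S" using P(2) that(2) assms(3) subspace_diff by blast
    have "(J w - P (J w)) \<bullet> (P w' - m) = 0" using P(3)[OF mem] .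
    moreover have eq: "J w - P (J w) = - (P w' - m)" using that(1) by (simp add: algebra_simps)
    ultimately have "(P w' - m) \<bullet> (P w' - m) = 0" by (simp only: inner_minus_left)
    then have "P w' - m = 0" by simp
    then show ?thesis using eq by simp
  qed
  \<comment> \<open>The residual of \<open>J w\<close> lies in the orthogonal complement of
    \<open>S\<close> and \<open>P w'\<close> in \<open>S\<close>; by \<open>split\<close>, an
    equation for their sum with right-hand side in \<open>S\<close> determines both.\<close>
  define A where "A = (\<lambda>(w, w'). (H w + adjoint J w', (J w - P (J w)) + P w'))"
  have linA: "linear A"
    unfolding A_def using assms(1,2) P(1) adjoint_linear[OF assms(2)]
    by (intro linearI) (auto simp: linear_add linear_scale algebra_simps)
  have "inj A"
    unfolding linear_injective_0[OF linA]
  proof (clarify)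
    fix w w' assume "A (w, w') = 0"
    then have 1: "H w + adjoint J w' = 0" and 2: "(J w - P (J w)) + P w' = 0"
      by (auto simp: A_def zero_prod_def)
    have 3: "J w - P (J w) = 0" "P w' - 0 = 0" using split[OF 2] assms(3) subspace_0 by blast+
    have "J w \<in> S" using P(2)[of "J w"] 3(1) by simp
    moreover have "w' \<bullet> s = 0" if "s \<in> S" for s using P(3)[OF that, of w'] 3(2) by simp
    ultimately show "(w, w') = 0" using inj 1 by (simp add: zero_prod_def)
  qed
  then have "surj A" using linear_injective_imp_surjective[OF linA] by blast
  then obtain yy where "A yy = (0, n)" by (metis surjD)
  then obtain y y' where "A (y, y') = (0, n)" by (cases yy) auto
  then have 1: "H y + adjoint J y' = 0" and 2: "(J y - P (J y)) + P y' = n"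
    by (auto simp: A_def)
  have 3: "J y - P (J y) = 0" "P y' - n = 0" using split[OF 2 assms(4)] by blast+
  have "J y \<in> S" using P(2)[of "J y"] 3(1) by simp
  moreover have "y' \<bullet> s = n \<bullet> s" if "s \<in> S" for s
    using P(3)[OF that, of y'] 3(2) by (simp add: inner_diff_left)
  ultimately show ?thesis using that 1 by blast
qed

text \<open>Climbing a chain of facets from the minimal face containing \<open>zb\<close>: each step enlarges
  by one dimension the subspace on which the form induced by \<open>H\<close> is positive definite, the coderivative
  condition for the facet pair deciding the sign.\<close>

lemma coderivative_condition_face:
  fixes H :: "'a::euclidean_space \<Rightarrow> 'a" and J :: "'a \<Rightarrow> 'b::euclidean_space"
    and E :: "('b \<times> real) set"
  assumes E: "polyhedron E"
    and H: "linear H" "\<And>v w. H v \<bullet> w = v \<bullet> H w" and J: "linear J"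
    and D: "\<And>w w'. \<lbrakk>H w + adjoint J w' = 0; (w', - J w) \<in> limiting_normal (subgradient_rel E) (zb, lb)\<rbrakk>
        \<Longrightarrow> w = 0 \<and> w' = 0"
    and F: "F face_of conj_face E lb" "zb \<in> F"
  shows "\<exists>L \<subseteq> span ((\<lambda>x. x - zb) ` F).
      (\<forall>l v. (zb, l) \<in> subgradient_rel E \<longrightarrow> v \<in> L \<longrightarrow> (l - lb) \<bullet> v = 0) \<and>
      (\<forall>w w'. H w + adjoint J w' = 0 \<longrightarrow> J w \<in> span ((\<lambda>x. x - zb) ` F) \<longrightarrow>
        (\<forall>v\<in>L. w' \<bullet> v = 0) \<longrightarrow> 0 \<le> J w \<bullet> w' \<longrightarrow> w = 0 \<and> w' = 0)"
  using F
proof (induction "nat (aff_dim F)" arbitrary: F rule: less_induct)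
  case less
  have cF: "convex F" using less.prems(1) face_of_imp_convex by blast
  have pF: "polyhedron F"
    using less.prems(1) polyhedron_conj_face[OF E] face_of_polyhedron_polyhedron by blast
  define S where "S = span ((\<lambda>x. x - zb) ` F)"
  have subS: "subspace S" by (simp add: S_def)
  \<comment> \<open>The coderivative condition, tested on the product of the orthogonal complement
    of \<open>S\<close> with \<open>S\<close>.\<close>
  have DS: "w = 0 \<and> w' = 0" if "H w + adjoint J w' = 0" "J w \<in> S" "\<And>s. s \<in> S \<Longrightarrow> w' \<bullet> s = 0" for w w'
  proof -
    have "- J w \<in> S" using that(2) subS subspace_neg by blast
    then have "(w', - J w) \<in> limiting_normal (subgradient_rel E) (zb, lb)"
      using limiting_normal_face_span[OF E less.prems] that(3) unfolding S_def by blast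
    then show ?thesis using D that(1) by blast
  qed
  show ?case
  proof (cases "zb \<in> rel_interior F")
    case True
    \<comment> \<open>Bottom of the chain: with \<open>zb\<close> in the relative interior of
      \<open>F\<close>, the choice \<open>L = S\<close> makes the claim on \<open>(w, w')\<close> an
      instance of \<open>DS\<close>. Larger faces inherit this \<open>L\<close>, the direction space
      of the smallest face containing \<open>zb\<close>.\<close>
    have "(l - lb) \<bullet> v = 0" if l: "(zb, l) \<in> subgradient_rel E" and v: "v \<in> S" for l v
    proof -
      have "(\<lambda>x. x - zb) ` F \<subseteq> {v. (l - lb) \<bullet> v = 0}"
        using subgradient_orthogonal_rel_interior[OF cF face_of_imp_subset[OF less.prems(1)] True l] by auto
      then have "S \<subseteq> {v. (l - lb) \<bullet> v = 0}"
        unfolding S_def by (intro span_minimal subspace_hyperplane)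
      then show ?thesis using v by blast
    qed
    then show ?thesis using DS S_def by (intro exI[of _ S]) blast
  next
    case False
    then have "zb \<in> rel_frontier F"
      using less.prems(2) closure_subset unfolding rel_frontier_def by blast
    then obtain F' where F': "F' facet_of F" "zb \<in> F'"
      using rel_frontier_of_polyhedron[OF pF] by blast
    have sub: "F' \<subseteq> F" using F'(1) facet_of_imp_subset by blast
    define S' where "S' = span ((\<lambda>x. x - zb) ` F')"
    have S'S: "S' \<subseteq> S" unfolding S_def S'_def using sub by (intro span_mono image_mono)
    \<comment> \<open>Needed because \<open>nat\<close> sends both the dimension -1 of the empty set
      and the dimension 0 to 0.\<close>
    have "0 \<le> aff_dim F'" using F'(2) aff_dim_negative_iff[of F'] by (metis empty_iff not_less)
    then have "nat (aff_dim F') < nat (aff_dim F)" using F'(1) unfolding facet_of_def by linarith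
    moreover have "F' face_of conj_face E lb"
      using F'(1) less.prems(1) facet_of_imp_face_of face_of_trans by blast
    ultimately obtain L where L: "L \<subseteq> S'"
      "\<And>l v. \<lbrakk>(zb, l) \<in> subgradient_rel E; v \<in> L\<rbrakk> \<Longrightarrow> (l - lb) \<bullet> v = 0"
      and IH: "\<And>w w'. \<lbrakk>H w + adjoint J w' = 0; J w \<in> S'; \<And>v. v \<in> L \<Longrightarrow> w' \<bullet> v = 0; 0 \<le> J w \<bullet> w'\<rbrakk>
          \<Longrightarrow> w = 0 \<and> w' = 0"
      using less.hyps[of F'] F'(2) unfolding S'_def by (metis (no_types, lifting))
    obtain n where n: "n \<in> S" "n \<noteq> 0" "\<And>x. x \<in> F \<Longrightarrow> 0 \<le> n \<bullet> (x - zb)"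
      "\<And>v. v \<in> S \<Longrightarrow> v \<in> S' \<longleftrightarrow> n \<bullet> v = 0"
      using facet_normal[OF pF F'] unfolding S_def S'_def by metis
    \<comment> \<open>This solution spans the direction added in passing from \<open>S'\<close> to
      \<open>S\<close>: its \<open>y'\<close> acts on \<open>S\<close> like the facet normal, hence
      vanishes on \<open>S'\<close>.\<close>
    obtain y y' where y: "H y + adjoint J y' = 0" "J y \<in> S" "\<And>s. s \<in> S \<Longrightarrow> y' \<bullet> s = n \<bullet> s"
      using reduced_system_solvable[OF H(1) J subS n(1)] DS by metis
    have "y' \<bullet> n \<noteq> 0" using y(3)[OF n(1)] n(2) by simp
    then have "y' \<noteq> 0" by auto
    have y'L: "y' \<bullet> v = 0" if "v \<in> L" for v
    proof -
      have "v \<in> S'" "v \<in> S" using that L(1) S'S by blast+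
      then show ?thesis using y(3) n(4) by simp
    qed
    \<comment> \<open>The sign of the form on the new direction, as
      \<open>J y \<bullet> y' = n \<bullet> J y\<close>. The value zero would put \<open>J y\<close>
      into \<open>S'\<close>, against the induction hypothesis; a positive value would make
      \<open>(- y, - y')\<close> violate the coderivative condition at the facet pair.\<close>
    have nJy: "n \<bullet> J y < 0"
    proof (rule ccontr)
      assume "\<not> ?thesis"
      then consider "n \<bullet> J y = 0" | "0 < n \<bullet> J y" by linarith
      then show False
      proof cases
        case 1
        then have "J y \<in> S'" using n(4) y(2) by blast
        moreover have "J y \<bullet> y' = 0" using y(3)[OF y(2)] 1 by (simp add: inner_commute)
        ultimately show False using IH[OF y(1)] y'L \<open>y' \<noteq> 0\<close> by simp
      next
        case 2
        have "(- y', J y) \<in> limiting_normal (subgradient_rel E) (zb, lb)"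
          by (rule limiting_normal_facet[OF E less.prems(1) F'])
            (use n y 2 in \<open>auto simp: S_def S'_def\<close>)
        moreover have "H (- y) + adjoint J (- y') = 0"
          using y(1) linear_neg[OF H(1)] linear_neg[OF adjoint_linear[OF J]]
          by (simp add: add_eq_0_iff)
        ultimately show False using D[of "- y" "- y'"] linear_neg[OF J] \<open>y' \<noteq> 0\<close> by simp
      qed
    qed
    have "w = 0 \<and> w' = 0" if w: "H w + adjoint J w' = 0" "J w \<in> S" "\<And>v. v \<in> L \<Longrightarrow> w' \<bullet> v = 0"
      "0 \<le> J w \<bullet> w'" for w w'
    proof -
      \<comment> \<open>Subtracting \<open>t\<close> times \<open>(y, y')\<close> removes the
        component of \<open>J w\<close> along \<open>n\<close> and brings the pair into the range of
        the induction hypothesis.\<close>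
      define t where "t = (n \<bullet> J w) / (n \<bullet> J y)"
      have t: "t * (n \<bullet> J y) = n \<bullet> J w" using nJy by (simp add: t_def)
      have aw: "adjoint J w' = - H w" using w(1) by (simp add: add_eq_0_iff2)
      have ay: "adjoint J y' = - H y" using y(1) by (simp add: add_eq_0_iff2)
      \<comment> \<open>Symmetry of \<open>H\<close> gives
        \<open>J y \<bullet> w' = J w \<bullet> y'\<close>: the form is symmetric on solutions of
        the linear system.\<close>
      have c: "J y \<bullet> w' = n \<bullet> J w"
      proof -
        have "J y \<bullet> w' = y \<bullet> adjoint J w'" using adjoint_works[OF J] by simp
        also have "\<dots> = w \<bullet> adjoint J y'" unfolding aw ay using H(2)[of w y] by (simp add: inner_commute)
        also have "\<dots> = J w \<bullet> y'" using adjoint_works[OF J] by simp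
        finally show ?thesis using y(3)[OF w(2)] by (simp add: inner_commute)
      qed
      have d: "J w \<bullet> y' = n \<bullet> J w" "J y \<bullet> y' = n \<bullet> J y"
        using y(3)[OF w(2)] y(3)[OF y(2)] by (simp_all add: inner_commute)
      define v where "v = w - t *\<^sub>R y"
      define v' where "v' = w' - t *\<^sub>R y'"
      have Jv: "J v = J w - t *\<^sub>R J y" by (simp add: v_def linear_diff[OF J] linear_scale[OF J])
      have "H v + adjoint J v' = 0"
        unfolding v_def v'_def using w(1) y(1) aw ay
        by (simp add: linear_diff[OF H(1)] linear_scale[OF H(1)] linear_diff[OF adjoint_linear[OF J]]
            linear_scale[OF adjoint_linear[OF J]])
      moreover have "J v \<in> S'"
      proof -
        have "J v \<in> S" unfolding Jv using w(2) y(2) subS subspace_diff subspace_scale by blast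
        moreover have "n \<bullet> J v = 0" unfolding Jv using t by (simp add: inner_diff_right)
        ultimately show ?thesis using n(4) by blast
      qed
      moreover have "v' \<bullet> u = 0" if "u \<in> L" for u
        using w(3)[OF that] y'L[OF that] by (simp add: v'_def inner_diff_left)
      \<comment> \<open>Completing the square: the mixed terms contribute
        \<open>- 2 * t * t * (n \<bullet> J y)\<close> and the square of the new direction adds
        \<open>t * t * (n \<bullet> J y)\<close>. Since \<open>n \<bullet> J y\<close> is negative,
        the form can only increase, which also forces \<open>t = 0\<close> in the end.\<close>
      moreover have Jvv: "J v \<bullet> v' = J w \<bullet> w' - t * t * (n \<bullet> J y)"
        unfolding Jv v'_def using c d t
        by (simp add: inner_diff_left inner_diff_right)
      then have "0 \<le> J v \<bullet> v'"
      proof -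
        have "t * t * (n \<bullet> J y) \<le> 0" using nJy by (simp add: mult_nonneg_nonpos)
        then show ?thesis using Jvv w(4) by simp
      qed
      ultimately have v0: "v = 0" "v' = 0" using IH by blast+
      then have "J v \<bullet> v' = 0" by simp
      then have "t * t * (n \<bullet> J y) \<ge> 0" using Jvv w(4) by simp
      then have "t * t \<le> 0" using nJy by (auto simp: zero_le_mult_iff)
      then have "t = 0" using zero_le_square[of t] by (metis order_antisym mult_eq_0_iff)
      then show ?thesis using v0 by (simp add: v_def v'_def)
    qed
    then show ?thesis using L S'S S_def by (intro exI[of _ L]) blast
  qed
qed

text \<open>The admissible triples form a closed cone on which the right-hand side is positively
  homogeneous and, by \<open>pos\<close>, vanishes only at zero; compactness of the unit sphere
  gives \<open>m\<close>. The variable \<open>s\<close> is kept apart from \<open>J w\<close>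
  because differences \<open>z - z'\<close> agree with \<open>J (x - x')\<close> only up to
  residuals.\<close>

lemma homogeneous_lower_bound:
  fixes H :: "'a::euclidean_space \<Rightarrow> 'a" and J :: "'a \<Rightarrow> 'b::euclidean_space"
  assumes H: "linear H" and J: "linear J" and S: "subspace S"
    and pos: "\<And>w w'. \<lbrakk>H w + adjoint J w' = 0; J w \<in> S; \<And>v. v \<in> L \<Longrightarrow> w' \<bullet> v = 0; 0 \<le> J w \<bullet> w'\<rbrakk>
          \<Longrightarrow> w = 0 \<and> w' = 0"
  shows "\<exists>m>0. \<forall>w w' s. s \<in> S \<longrightarrow> (\<forall>v\<in>L. w' \<bullet> v = 0) \<longrightarrow> 0 \<le> s \<bullet> w' \<longrightarrow>
      m * norm (w, w', s) \<le> norm (H w + adjoint J w') + norm (s - J w)"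
proof -
  define C where "C = {(w::'a, w', s). s \<in> S \<and> (\<forall>v\<in>L. w' \<bullet> v = 0) \<and> 0 \<le> s \<bullet> w'}"
  define h where "h = (\<lambda>(w, w', s). norm (H w + adjoint J w') + norm (s - J w))"
  have clin: "continuous_on X H" "continuous_on Y J" "continuous_on Z (adjoint J)" for X Y Z
    using H J adjoint_linear[OF J] linear_continuous_on linear_conv_bounded_linear by blast+
  have "C = UNIV \<times> (UNIV \<times> S) \<inter> ((\<Inter>v\<in>L. {x. fst (snd x) \<bullet> v = 0}) \<inter> {x. 0 \<le> snd (snd x) \<bullet> fst (snd x)})"
    by (auto simp: C_def)
  moreover have "closed \<dots>"
    using closed_subspace[OF S]
    by (intro closed_Int closed_INT closed_Times ballI closed_Collect_eq closed_Collect_le continuous_intros) auto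
  ultimately have clC: "closed C" by simp
  have comp: "compact (sphere 0 1 \<inter> C)" using clC by (intro compact_Int_closed) auto
  have conth: "continuous_on (sphere 0 1 \<inter> C) h"
    unfolding h_def case_prod_unfold
    by (intro continuous_intros continuous_on_compose2[OF clin(1)[of UNIV]]
        continuous_on_compose2[OF clin(2)[of UNIV]] continuous_on_compose2[OF clin(3)[of UNIV]]) auto
  have hpos: "0 < h x" if "x \<in> sphere 0 1 \<inter> C" for x
  proof -
    obtain w w' s where x: "x = (w, w', s)" by (cases x)
    have C: "s \<in> S" "\<And>v. v \<in> L \<Longrightarrow> w' \<bullet> v = 0" "0 \<le> s \<bullet> w'" using that x C_def by auto
    have "h x \<noteq> 0"
    proof
      assume "h x = 0"
      then have "H w + adjoint J w' = 0" "s = J w" by (auto simp: h_def x add_nonneg_eq_0_iff)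
      then have "w = 0" "w' = 0" using pos C by blast+
      then have "x = 0" using \<open>s = J w\<close> x linear_0[OF J] by (simp add: zero_prod_def)
      then show False using that by simp
    qed
    moreover have "0 \<le> h x" by (simp add: h_def x)
    ultimately show ?thesis by simp
  qed
  obtain m where m: "0 < m" "\<And>x. x \<in> sphere 0 1 \<inter> C \<Longrightarrow> m \<le> h x"
  proof (cases "sphere 0 1 \<inter> C = {}")
    case True
    then show ?thesis using that[of 1] by auto
  next
    case False
    then obtain x where "x \<in> sphere 0 1 \<inter> C" "\<And>y. y \<in> sphere 0 1 \<inter> C \<Longrightarrow> h x \<le> h y"
      using continuous_attains_inf[OF comp _ conth] by metis
    then show ?thesis using that[of "h x"] hpos by blast
  qed
  show ?thesis
  proof (intro exI[of _ m] conjI allI impI m(1))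
    fix w :: 'a and w' s :: 'b
    assume C: "s \<in> S" "\<forall>v\<in>L. w' \<bullet> v = 0" "0 \<le> s \<bullet> w'"
    define x where "x = (w, w', s)"
    show "m * norm (w, w', s) \<le> norm (H w + adjoint J w') + norm (s - J w)"
    proof (cases "x = 0")
      case True
      then show ?thesis by (simp add: x_def[symmetric])
    next
      case False
      define k where "k = inverse (norm x)"
      have k: "0 < k" "k * norm x = 1" using False by (auto simp: k_def)
      have kx: "k *\<^sub>R x = (k *\<^sub>R w, k *\<^sub>R w', k *\<^sub>R s)" by (simp add: x_def)
      have "k *\<^sub>R x \<in> C" unfolding kx C_def using C S subspace_scale k(1) by auto
      moreover have "norm (k *\<^sub>R x) = 1" using k by simp
      ultimately have "m \<le> h (k *\<^sub>R x)" using m(2) by simp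
      also have "h (k *\<^sub>R x) = k * (norm (H w + adjoint J w') + norm (s - J w))"
      proof -
        have "H (k *\<^sub>R w) + adjoint J (k *\<^sub>R w') = k *\<^sub>R (H w + adjoint J w')"
          "k *\<^sub>R s - J (k *\<^sub>R w) = k *\<^sub>R (s - J w)"
          by (simp_all add: linear_scale[OF H] linear_scale[OF J] linear_scale[OF adjoint_linear[OF J]] algebra_simps)
        then show ?thesis unfolding h_def kx using k(1) by (simp add: distrib_left)
      qed
      finally have "m * norm x \<le> (k * norm x) * (norm (H w + adjoint J w') + norm (s - J w))"
        by (metis mult.assoc mult.commute mult_right_mono norm_ge_zero)
      then show ?thesis unfolding k(2) by (simp add: x_def)
    qed
  qed
qed

section \<open>Resolvents and conjugates\<close>

text \<open>The proximal point: \<open>z\<close> minimises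
  \<open>t + (norm (y - v))\<^sup>2 / 2\<close> over \<open>E\<close>, and the optimality condition
  makes \<open>v - z\<close> a subgradient. The given subgradient \<open>l0\<close> supplies an
  affine minorant, hence compactness of the sublevel set \<open>E'\<close>.\<close>

lemma subgradient_rel_resolvent:
  fixes E :: "('b::euclidean_space \<times> real) set"
  assumes E: "convex E" "closed E" and ne: "(z0, l0) \<in> subgradient_rel E"
  shows "\<exists>z. (z, v - z) \<in> subgradient_rel E"
proof -
  obtain r0 where r0: "(z0, r0) \<in> E" "\<And>y t. (y, t) \<in> E \<Longrightarrow> l0 \<bullet> y - t \<le> l0 \<bullet> z0 - r0"
    using subgradient_relE[OF ne] by metis
  define h :: "'b \<times> real \<Rightarrow> real" where "h x = snd x + (norm (fst x - v))\<^sup>2 / 2" for x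
  have conth: "continuous_on X h" for X unfolding h_def by (intro continuous_intros) auto
  define E' where "E' = E \<inter> {x. h x \<le> h (z0, r0)}"
  \<comment> \<open>Bound on the squared distance to \<open>v\<close> over \<open>E'\<close>: the
    linear term is at most \<open>(norm l0)\<^sup>2 + (norm (y - v))\<^sup>2 / 4\<close>, which
    leaves a quarter of the square, whence the factor 4.\<close>
  define M where "M = 4 * ((norm l0)\<^sup>2 + (norm (z0 - v))\<^sup>2 / 2 - l0 \<bullet> (v - z0))"
  have bd: "norm (y - v) \<le> M + 1 \<and> r0 - norm l0 * (M + 1 + norm (v - z0)) \<le> t \<and> t \<le> h (z0, r0)"
    if "(y, t) \<in> E'" for y t
  proof -
    have yt: "(y, t) \<in> E" "t + (norm (y - v))\<^sup>2 / 2 \<le> h (z0, r0)" using that by (auto simp: E'_def h_def)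
    have t: "r0 + l0 \<bullet> (y - z0) \<le> t" using r0(2)[OF yt(1)] by (simp add: inner_diff_right)
    have sp: "l0 \<bullet> (y - z0) = l0 \<bullet> (y - v) + l0 \<bullet> (v - z0)" by (simp add: inner_diff_right)
    have "- (norm l0 * norm (y - v)) \<le> l0 \<bullet> (y - v)"
      using Cauchy_Schwarz_ineq2[of l0 "y - v"] by linarith
    moreover have "norm l0 * norm (y - v) \<le> (norm l0)\<^sup>2 + (norm (y - v))\<^sup>2 / 4"
    proof -
      have "0 \<le> (norm l0 - norm (y - v) / 2)\<^sup>2" by simp
      then show ?thesis by (simp add: power2_eq_square field_simps)
    qed
    moreover have "(norm (y - v))\<^sup>2 / 2 \<le> (norm (z0 - v))\<^sup>2 / 2 - l0 \<bullet> (y - v) - l0 \<bullet> (v - z0)"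
      using t[unfolded sp] yt(2) unfolding h_def fst_conv snd_conv by linarith
    ultimately have *: "(norm (y - v))\<^sup>2 \<le> M" unfolding M_def by argo
    have 1: "norm (y - v) \<le> M + 1"
    proof -
      have "0 \<le> (norm (y - v) - 1/2)\<^sup>2" by simp
      then have "norm (y - v) \<le> (norm (y - v))\<^sup>2 + 1/4" by (simp add: power2_eq_square field_simps)
      then show ?thesis using * by linarith
    qed
    have "norm (y - z0) \<le> M + 1 + norm (v - z0)"
      using norm_triangle_ineq[of "y - v" "v - z0"] 1 by simp
    then have "norm l0 * norm (y - z0) \<le> norm l0 * (M + 1 + norm (v - z0))"
      by (intro mult_left_mono) auto
    then have "r0 - norm l0 * (M + 1 + norm (v - z0)) \<le> t"
      using t Cauchy_Schwarz_ineq2[of l0 "y - z0"] by linarith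
    moreover have "t \<le> h (z0, r0)" using yt(2) zero_le_power2[of "norm (y - v)"] by linarith
    ultimately show ?thesis using 1 by simp
  qed
  have "E' \<subseteq> cball v (M + 1) \<times> {r0 - norm l0 * (M + 1 + norm (v - z0)) .. h (z0, r0)}"
    using bd by (auto simp: dist_norm norm_minus_commute)
  then have "bounded E'" by (rule bounded_subset[rotated]) (intro bounded_Times bounded_cball bounded_closed_interval)
  moreover have "closed E'"
    unfolding E'_def using E(2) conth by (intro closed_Int closed_Collect_le continuous_on_const) auto
  ultimately have "compact E'" by (simp add: compact_eq_bounded_closed)
  moreover have "(z0, r0) \<in> E'" using r0 by (simp add: E'_def)
  ultimately obtain x where x: "x \<in> E'" "\<And>x'. x' \<in> E' \<Longrightarrow> h x \<le> h x'"
    using continuous_attains_inf[of E' h] conth by blast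
  obtain z r where zr: "x = (z, r)" by (cases x)
  have min: "h (z, r) \<le> h x'" if "x' \<in> E" for x'
    using x that zr unfolding E'_def by (cases "h x' \<le> h (z0, r0)") auto
  have zrE: "(z, r) \<in> E" using x(1) zr E'_def by blast
  have "(v - z) \<bullet> y - t \<le> (v - z) \<bullet> z - r" if yt: "(y, t) \<in> E" for y t
  proof -
    define A where "A = (t - r) + (z - v) \<bullet> (y - z)"
    define B where "B = (norm (y - z))\<^sup>2 / 2"
    \<comment> \<open>Minimality along the segment from \<open>(z, r)\<close> to
      \<open>(y, t)\<close>, divided by \<open>s\<close>; letting \<open>s\<close> tend to 0 leaves
      the first-order term \<open>A\<close>.\<close>
    have ineq: "0 \<le> A + s * B" if s: "0 < s" "s < 1" for s
    proof -
      have "(1 - s) *\<^sub>R (z, r) + s *\<^sub>R (y, t) \<in> E"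
        using s zrE yt E(1) by (intro convexD_alt) auto
      moreover have "(1 - s) *\<^sub>R (z, r) + s *\<^sub>R (y, t) = (z + s *\<^sub>R (y - z), r + s * (t - r))"
        by (simp add: algebra_simps)
      ultimately have "h (z, r) \<le> h (z + s *\<^sub>R (y - z), r + s * (t - r))" using min by metis
      moreover have "z + s *\<^sub>R (y - z) - v = (z - v) + s *\<^sub>R (y - z)" by simp
      ultimately have "r + (norm (z - v))\<^sup>2 / 2
          \<le> r + s * (t - r) + (norm ((z - v) + s *\<^sub>R (y - z)))\<^sup>2 / 2"
        unfolding h_def by simp
      also have "(norm ((z - v) + s *\<^sub>R (y - z)))\<^sup>2
          = (norm (z - v))\<^sup>2 + 2 * s * ((z - v) \<bullet> (y - z)) + s\<^sup>2 * (norm (y - z))\<^sup>2"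
        unfolding power2_norm_eq_inner inner_add_left inner_add_right inner_scaleR_left inner_scaleR_right
        by (simp add: inner_commute[of "y - z" "z - v"] power2_eq_square distrib_left)
      finally have "0 \<le> s * (A + s * B)"
        unfolding A_def B_def by (simp add: field_simps power2_eq_square)
      then show ?thesis using s(1) by (simp add: zero_le_mult_iff)
    qed
    have "((\<lambda>s. A + s * B) \<longlongrightarrow> A + 0 * B) (at_right 0)" by (intro tendsto_intros)
    moreover have "eventually (\<lambda>s::real. 0 < s \<and> s < 1) (at_right 0)"
      by (auto simp: eventually_at_right_field intro!: exI[of _ 1])
    then have "eventually (\<lambda>s. 0 \<le> A + s * B) (at_right 0)"
      by eventually_elim (use ineq in auto)
    ultimately have "0 \<le> A + 0 * B" using tendsto_lowerbound trivial_limit_at_right_real by blast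
    then show ?thesis
      unfolding A_def by (simp add: inner_diff_left inner_diff_right inner_commute)
  qed
  then show ?thesis unfolding subgradient_rel_def using zrE by blast
qed

section \<open>The subdifferentials of \<open>g\<close> and of its conjugate as one relation\<close>

lemma mem_epigraph: "(y, t) \<in> epigraph g \<longleftrightarrow> g y \<le> ereal t"
  by (simp add: epigraph_def)

lemma subdiff_iff_subgradient_rel:
  fixes g :: "'b::euclidean_space \<Rightarrow> ereal"
  assumes "proper_fun g"
  shows "l \<in> subdiff g z \<longleftrightarrow> (z, l) \<in> subgradient_rel (epigraph g)"
proof
  assume l: "l \<in> subdiff g z"
  then obtain r where r: "g z = ereal r" unfolding subdiff_def by (cases "g z") auto
  have "l \<bullet> y - t \<le> l \<bullet> z - r" if "(y, t) \<in> epigraph g" for y t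
  proof -
    have "g z + ereal (l \<bullet> (y - z)) \<le> ereal t"
      using l that order_trans unfolding subdiff_def mem_epigraph by blast
    then show ?thesis using r by (simp add: inner_diff_right)
  qed
  then show "(z, l) \<in> subgradient_rel (epigraph g)"
    unfolding subgradient_rel_def using r by (auto simp: mem_epigraph intro!: exI[of _ r])
next
  assume "(z, l) \<in> subgradient_rel (epigraph g)"
  from subgradient_relE[OF this, unfolded mem_epigraph]
  obtain r where r: "g z \<le> ereal r" "\<And>y t. g y \<le> ereal t \<Longrightarrow> l \<bullet> y - t \<le> l \<bullet> z - r"
    by metis
  have nm: "g y \<noteq> -\<infinity>" for y using assms unfolding proper_fun_def by blast
  obtain r' where r': "g z = ereal r'" using r(1) nm[of z] by (cases "g z") auto
  have "r' \<le> r" using r(1) r' by simp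
  have "g z + ereal (l \<bullet> (y - z)) \<le> g y" for y
  proof (cases "g y")
    case (real t)
    then show ?thesis using r(2)[of y t] r' \<open>r' \<le> r\<close> by (simp add: inner_diff_right)
  qed (use nm in auto)
  then show "l \<in> subdiff g z" unfolding subdiff_def using r' by simp
qed

lemma fconj_le_iff:
  fixes g :: "'b::euclidean_space \<Rightarrow> ereal"
  assumes "proper_fun g"
  shows "fconj g l \<le> ereal c \<longleftrightarrow> (\<forall>y t. (y, t) \<in> epigraph g \<longrightarrow> l \<bullet> y - t \<le> c)"
proof -
  have nm: "g y \<noteq> -\<infinity>" for y using assms unfolding proper_fun_def by blast
  have "ereal (l \<bullet> y) - g y \<le> ereal c \<longleftrightarrow> (\<forall>t. (y, t) \<in> epigraph g \<longrightarrow> l \<bullet> y - t \<le> c)" for y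
  proof (cases "g y")
    case (real r)
    have "(\<forall>t\<ge>r. l \<bullet> y - t \<le> c) \<longleftrightarrow> l \<bullet> y - r \<le> c" by (auto intro: order_trans)
    then show ?thesis using real by (auto simp: mem_epigraph)
  qed (use nm in \<open>auto simp: mem_epigraph\<close>)
  then show ?thesis unfolding fconj_def SUP_le_iff by blast
qed

text \<open>The subdifferential of the conjugate inverts that of \<open>g\<close>. The implication
  from right to left is the Fenchel-Young inequality; the converse needs a separation argument,
  since it must recover a point of the epigraph from \<open>fconj g\<close> alone.\<close>

lemma subdiff_fconj_iff_subgradient_rel:
  fixes g :: "'b::euclidean_space \<Rightarrow> ereal"
  assumes g: "proper_fun g" and E: "convex (epigraph g)" "closed (epigraph g)"
  shows "z \<in> subdiff (fconj g) l \<longleftrightarrow> (z, l) \<in> subgradient_rel (epigraph g)"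
proof
  assume "(z, l) \<in> subgradient_rel (epigraph g)"
  then obtain r where r: "(z, r) \<in> epigraph g" "\<And>y t. (y, t) \<in> epigraph g \<Longrightarrow> l \<bullet> y - t \<le> l \<bullet> z - r"
    using subgradient_relE by metis
  have low: "ereal (\<mu> \<bullet> z - r) \<le> fconj g \<mu>" for \<mu>
  proof -
    have "ereal (\<mu> \<bullet> z - r) \<le> ereal (\<mu> \<bullet> z) - g z"
      using r(1) g unfolding mem_epigraph proper_fun_def by (cases "g z") auto
    also have "\<dots> \<le> fconj g \<mu>" unfolding fconj_def by (rule SUP_upper) simp
    finally show ?thesis .
  qed
  have "fconj g l = ereal (l \<bullet> z - r)"
    using low[of l] fconj_le_iff[OF g] r(2) by (intro antisym) auto
  then show "z \<in> subdiff (fconj g) l"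
    unfolding subdiff_def using low by (auto simp: inner_diff_right inner_commute algebra_simps)
next
  assume z: "z \<in> subdiff (fconj g) l"
  then obtain k where k: "fconj g l = ereal k" unfolding subdiff_def by (cases "fconj g l") auto
  have sub: "k + z \<bullet> (\<mu> - l) \<le> c" if "fconj g \<mu> \<le> ereal c" for \<mu> c
  proof -
    have "fconj g l + ereal (z \<bullet> (\<mu> - l)) \<le> ereal c"
      using z that order_trans unfolding subdiff_def by blast
    then show ?thesis using k by simp
  qed
  have kE: "l \<bullet> y - t \<le> k" if "(y, t) \<in> epigraph g" for y t
    using fconj_le_iff[OF g, of l k] k that by simp
  define \<alpha> where "\<alpha> = l \<bullet> z - k"
  have "(z, \<alpha>) \<in> epigraph g"
  proof (rule ccontr)
    assume "(z, \<alpha>) \<notin> epigraph g"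
    then obtain a b where ab: "a \<bullet> (z, \<alpha>) < b" "\<And>x. x \<in> epigraph g \<Longrightarrow> b < a \<bullet> x"
      using separating_hyperplane_closed_point[OF E] by metis
    obtain \<mu> \<beta> where a: "a = (\<mu>, \<beta>)" by (cases a)
    \<comment> \<open>The separating functional \<open>(\<mu>, \<beta>)\<close> may be vertical or
      have a last coordinate of either sign, so it is only mixed in:
      \<open>(l, -1) - s *\<^sub>R (\<mu>, \<beta>)\<close> is \<open>\<theta>\<close> times
      \<open>(lq, -1)\<close>, and this \<open>s\<close> keeps \<open>\<theta>\<close> positive. The
      conjugate at \<open>lq\<close> then lies below what the subgradient inequality at
      \<open>l\<close> allows.\<close>
    define s where "s = 1 / (1 + \<bar>\<beta>\<bar>)"
    define \<theta> where "\<theta> = 1 + s * \<beta>"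
    have s: "0 < s" by (simp add: s_def add_pos_nonneg)
    have "s * \<bar>\<beta>\<bar> < 1" by (simp add: s_def field_simps)
    then have th: "0 < \<theta>"
      unfolding \<theta>_def using s abs_mult[of s \<beta>] by (simp add: abs_if split: if_splits)
    define lq where "lq = (1 / \<theta>) *\<^sub>R (l - s *\<^sub>R \<mu>)"
    have lam: "\<theta> * (lq \<bullet> y) = l \<bullet> y - s * (\<mu> \<bullet> y)" for y
      unfolding lq_def using th by (simp add: inner_diff_left)
    have "lq \<bullet> y - t \<le> (k - s * b) / \<theta>" if yt: "(y, t) \<in> epigraph g" for y t
    proof -
      have "b < \<mu> \<bullet> y + \<beta> * t" using ab(2)[OF yt] a by simp
      then have "s * b \<le> s * (\<mu> \<bullet> y + \<beta> * t)" using s by (intro mult_left_mono) auto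
      then have "\<theta> * (lq \<bullet> y - t) \<le> k - s * b"
        using kE[OF yt] unfolding right_diff_distrib lam by (simp add: \<theta>_def algebra_simps)
      then show ?thesis using th by (simp add: pos_le_divide_eq mult.commute)
    qed
    then have "fconj g lq \<le> ereal ((k - s * b) / \<theta>)" using fconj_le_iff[OF g] by blast
    then have "k + z \<bullet> (lq - l) \<le> (k - s * b) / \<theta>" using sub by blast
    then have "\<theta> * (k + z \<bullet> (lq - l)) \<le> k - s * b" using th by (simp add: pos_le_divide_eq mult.commute)
    moreover have "\<theta> * (k + z \<bullet> (lq - l)) = k - s * (\<mu> \<bullet> z + \<beta> * \<alpha>)"
    proof -
      have "\<theta> * (k + z \<bullet> (lq - l)) = \<theta> * (lq \<bullet> z) - \<theta> * \<alpha>"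
        by (simp add: \<alpha>_def inner_diff_right inner_commute algebra_simps)
      then show ?thesis unfolding lam by (simp add: \<theta>_def \<alpha>_def algebra_simps)
    qed
    moreover have "s * (\<mu> \<bullet> z + \<beta> * \<alpha>) < s * b" using ab(1) a s by simp
    ultimately show False by linarith
  qed
  moreover have "l \<bullet> y - t \<le> l \<bullet> z - \<alpha>" if "(y, t) \<in> epigraph g" for y t
    using kE[OF that] by (simp add: \<alpha>_def)
  ultimately show "(z, l) \<in> subgradient_rel (epigraph g)" unfolding subgradient_rel_def by blast
qed

text \<open>Inverting the subdifferential of the conjugate moves the perturbation \<open>b\<close>
  into the argument \<open>z = b + \<Phi> x\<close> of \<partial>g, so solutions correspond to
  points of its graph.\<close>

lemma mem_S_KKT_iff:
  fixes g :: "'b::euclidean_space \<Rightarrow> ereal" and \<Phi> :: "'a::euclidean_space \<Rightarrow> 'b"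
  assumes "proper_fun g" "convex (epigraph g)" "closed (epigraph g)"
  shows "(x, l) \<in> S_KKT \<phi> \<Phi> g (a, b) \<longleftrightarrow>
    gradL \<phi> \<Phi> x l = a \<and> (b + \<Phi> x, l) \<in> subgradient_rel (epigraph g)"
proof -
  have "(x, l) \<in> S_KKT \<phi> \<Phi> g (a, b) \<longleftrightarrow>
      gradL \<phi> \<Phi> x l = a \<and> (\<exists>u. b = - \<Phi> x + u \<and> (u, l) \<in> subgradient_rel (epigraph g))"
    unfolding S_KKT_def inv_map_def Psi_def using subdiff_fconj_iff_subgradient_rel[OF assms] by auto
  also have "\<dots> \<longleftrightarrow> gradL \<phi> \<Phi> x l = a \<and> (b + \<Phi> x, l) \<in> subgradient_rel (epigraph g)"
    by (metis add.commute add_minus_cancel minus_add_cancel)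
  finally show ?thesis .
qed

section \<open>Second derivatives\<close>

text \<open>The second difference is symmetric in \<open>u\<close> and \<open>v\<close>, whereas its
  leading term is \<open>l \<bullet> f'' u v\<close>; comparing both orders yields symmetry. Pairing
  with \<open>l\<close> makes the mean value theorem available for vector values.\<close>

lemma second_difference_bound:
  fixes f :: "'a::real_normed_vector \<Rightarrow> 'c::real_inner" and f' :: "'a \<Rightarrow> 'a \<Rightarrow>\<^sub>L 'c"
  assumes f: "\<And>x. (f has_derivative blinfun_apply (f' x)) (at x)"
    and f'': "(f' has_derivative blinfun_apply f'') (at x)"
    and "0 < e"
  obtains d where "0 < d"
    "\<And>t. \<lbrakk>0 < t; t < d\<rbrakk> \<Longrightarrow>
      \<bar>l \<bullet> (f (x + t *\<^sub>R u + t *\<^sub>R v) - f (x + t *\<^sub>R u) - f (x + t *\<^sub>R v) + f x) - t\<^sup>2 * (l \<bullet> f'' u v)\<bar>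
        \<le> e * t\<^sup>2"
proof -
  \<comment> \<open>Collects the factors of the final error estimate; the summand 1 keeps
    \<open>e / c\<close> meaningful when they vanish.\<close>
  define c where "c = 2 * norm l * (norm u + norm v) * norm v + 1"
  have c: "0 < c" by (simp add: c_def add_nonneg_pos)
  define e' where "e' = e / c"
  have e': "0 < e'" using c assms(3) by (simp add: e'_def)
  obtain d where d: "0 < d" "\<And>y. norm y < d \<Longrightarrow> norm (f' (x + y) - f' x - f'' y) \<le> e' * norm y"
    using f''[unfolded has_derivative_at_alt] e'
    by (metis (no_types, opaque_lifting) add_diff_cancel_left')
  define N where "N = norm u + norm v"
  define d' where "d' = d / (N + 1)"
  have N: "0 \<le> N" by (simp add: N_def)
  have d': "0 < d'" using d(1) N by (simp add: d'_def)
  show ?thesis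
  proof (rule that[OF d'])
    fix t :: real assume t: "0 < t" "t < d'"
    have tN: "t * N < d"
    proof -
      have "t * (N + 1) < d" using t N unfolding d'_def by (simp add: pos_less_divide_eq)
      then show ?thesis using t(1) by (simp add: distrib_left)
    qed
    \<comment> \<open>The increment along \<open>u\<close>, followed along \<open>v\<close>:
      \<open>q 1 - q 0\<close> is the second difference, and its derivative compares
      \<open>f'\<close> at two points that differ by \<open>t *\<^sub>R u\<close>, both expanded
      around \<open>x\<close>.\<close>
    define q where "q s = l \<bullet> (f (x + t *\<^sub>R u + s *\<^sub>R (t *\<^sub>R v)) - f (x + s *\<^sub>R (t *\<^sub>R v)))" for s
    define q' where "q' s = l \<bullet> (f' (x + t *\<^sub>R u + s *\<^sub>R (t *\<^sub>R v)) (t *\<^sub>R v) - f' (x + s *\<^sub>R (t *\<^sub>R v)) (t *\<^sub>R v))" for s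
    have "(q has_derivative (*) (q' s)) (at s)" for s
    proof -
      have a: "((\<lambda>s. f (y + s *\<^sub>R (t *\<^sub>R v))) has_derivative (\<lambda>h. f' (y + s *\<^sub>R (t *\<^sub>R v)) (h *\<^sub>R (t *\<^sub>R v)))) (at s)" for y
        by (rule has_derivative_compose[OF _ f]) (auto intro!: derivative_eq_intros)
      have "(q has_derivative (\<lambda>h. l \<bullet> (f' (x + t *\<^sub>R u + s *\<^sub>R (t *\<^sub>R v)) (h *\<^sub>R (t *\<^sub>R v)) - f' (x + s *\<^sub>R (t *\<^sub>R v)) (h *\<^sub>R (t *\<^sub>R v))))) (at s)"
        unfolding q_def by (intro has_derivative_inner_right has_derivative_diff a)
      moreover have "(\<lambda>h. l \<bullet> (f' (x + t *\<^sub>R u + s *\<^sub>R (t *\<^sub>R v)) (h *\<^sub>R (t *\<^sub>R v)) - f' (x + s *\<^sub>R (t *\<^sub>R v)) (h *\<^sub>R (t *\<^sub>R v)))) = (*) (q' s)"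
        by (rule ext) (simp add: q'_def blinfun.scaleR_right inner_diff_right algebra_simps)
      ultimately show ?thesis by simp
    qed
    then have "DERIV q s :> q' s" for s
      by (simp add: has_field_derivative_def)
    then obtain \<xi> where xi: "0 < \<xi>" "\<xi> < 1" "q 1 - q 0 = q' \<xi>"
      using MVT2[of 0 1 q q'] by auto
    define y1 where "y1 = t *\<^sub>R u + (\<xi> * t) *\<^sub>R v"
    define y2 where "y2 = (\<xi> * t) *\<^sub>R v"
    have xt: "\<xi> * t \<le> t" "0 \<le> \<xi> * t" using xi t(1) by simp_all
    have n2: "norm y2 \<le> t * norm v"
      unfolding y2_def using xt by (simp add: mult_right_mono)
    have "norm y1 \<le> t * norm u + t * norm v"
      unfolding y1_def using norm_triangle_ineq[of "t *\<^sub>R u" y2] n2 t(1) by (simp add: y2_def)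
    then have n1: "norm y1 \<le> t * N" by (simp add: N_def distrib_left)
    have "t * norm v \<le> t * N" using t(1) by (intro mult_left_mono) (auto simp: N_def)
    then have n2': "norm y2 \<le> t * N" using n2 by simp
    define r1 where "r1 = f' (x + y1) - f' x - f'' y1"
    define r2 where "r2 = f' (x + y2) - f' x - f'' y2"
    have r: "norm r1 \<le> e' * (t * N)" "norm r2 \<le> e' * (t * N)"
      using d(2)[of y1] d(2)[of y2] n1 n2' tN e' unfolding r1_def r2_def
      by (meson less_imp_le mult_left_mono order_trans le_less_trans)+
    have "y1 - y2 = t *\<^sub>R u" by (simp add: y1_def y2_def)
    then have ff: "f'' y1 - f'' y2 = t *\<^sub>R f'' u" by (metis blinfun.diff_right blinfun.scaleR_right)
    have diff: "f' (x + y1) - f' (x + y2) = t *\<^sub>R f'' u + (r1 - r2)"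
      unfolding ff[symmetric] r1_def r2_def by simp
    have "q' \<xi> = l \<bullet> ((f' (x + y1) - f' (x + y2)) (t *\<^sub>R v))"
      unfolding q'_def y1_def y2_def by (simp add: blinfun.diff_left add.assoc)
    also have "\<dots> = t\<^sup>2 * (l \<bullet> f'' u v) + t * (l \<bullet> (r1 - r2) v)"
      unfolding diff blinfun.scaleR_right blinfun.add_left blinfun.scaleR_left
      by (simp add: power2_eq_square inner_add_right distrib_left)
    finally have chi: "q 1 - q 0 - t\<^sup>2 * (l \<bullet> f'' u v) = t * (l \<bullet> (r1 - r2) v)" using xi(3) by simp
    have "\<bar>l \<bullet> (r1 - r2) v\<bar> \<le> norm l * (norm (r1 - r2) * norm v)"
      by (meson Cauchy_Schwarz_ineq2 mult_left_mono norm_blinfun norm_ge_zero order_trans)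
    also have "\<dots> \<le> norm l * (2 * (e' * (t * N)) * norm v)"
      using r norm_triangle_ineq4[of r1 r2] by (intro mult_left_mono mult_right_mono) auto
    also have "\<dots> = t * e' * (2 * norm l * N * norm v)" by simp
    also have "\<dots> \<le> t * e' * c"
      using t(1) e' by (intro mult_left_mono) (auto simp: c_def N_def)
    also have "\<dots> = t * e" using c by (simp add: e'_def)
    finally have "\<bar>t * (l \<bullet> (r1 - r2) v)\<bar> \<le> e * t\<^sup>2"
      using t(1) by (simp add: abs_mult power2_eq_square mult.commute)
    moreover have "q 1 - q 0 = l \<bullet> (f (x + t *\<^sub>R u + t *\<^sub>R v) - f (x + t *\<^sub>R u) - f (x + t *\<^sub>R v) + f x)"
      unfolding q_def by (simp add: inner_diff_right inner_add_right)
    ultimately show "\<bar>l \<bullet> (f (x + t *\<^sub>R u + t *\<^sub>R v) - f (x + t *\<^sub>R u) - f (x + t *\<^sub>R v) + f x) - t\<^sup>2 * (l \<bullet> f'' u v)\<bar>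
        \<le> e * t\<^sup>2"
      using chi by simp
  qed
qed

lemma second_derivative_symmetric:
  fixes f :: "'a::real_normed_vector \<Rightarrow> 'c::real_inner" and f' :: "'a \<Rightarrow> 'a \<Rightarrow>\<^sub>L 'c"
  assumes f: "\<And>x. (f has_derivative blinfun_apply (f' x)) (at x)"
    and f'': "(f' has_derivative blinfun_apply f'') (at x)"
  shows "f'' u v = f'' v u"
proof -
  define l where "l = f'' u v - f'' v u"
  have "\<bar>l \<bullet> f'' u v - l \<bullet> f'' v u\<bar> \<le> 0 + e" if "0 < e" for e
  proof -
    obtain d1 where d1: "0 < d1" "\<And>t. \<lbrakk>0 < t; t < d1\<rbrakk> \<Longrightarrow>
      \<bar>l \<bullet> (f (x + t *\<^sub>R u + t *\<^sub>R v) - f (x + t *\<^sub>R u) - f (x + t *\<^sub>R v) + f x) - t\<^sup>2 * (l \<bullet> f'' u v)\<bar>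
        \<le> e/2 * t\<^sup>2"
      using second_difference_bound[OF f f'', of "e/2" l u v] \<open>0 < e\<close> by (metis half_gt_zero)
    obtain d2 where d2: "0 < d2" "\<And>t. \<lbrakk>0 < t; t < d2\<rbrakk> \<Longrightarrow>
      \<bar>l \<bullet> (f (x + t *\<^sub>R v + t *\<^sub>R u) - f (x + t *\<^sub>R v) - f (x + t *\<^sub>R u) + f x) - t\<^sup>2 * (l \<bullet> f'' v u)\<bar>
        \<le> e/2 * t\<^sup>2"
      using second_difference_bound[OF f f'', of "e/2" l v u] \<open>0 < e\<close> by (metis half_gt_zero)
    define t where "t = min d1 d2 / 2"
    have t: "0 < t" "t < d1" "t < d2" using d1(1) d2(1) by (auto simp: t_def min_def)
    define D where "D = l \<bullet> (f (x + t *\<^sub>R u + t *\<^sub>R v) - f (x + t *\<^sub>R u) - f (x + t *\<^sub>R v) + f x)"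
    have "x + t *\<^sub>R v + t *\<^sub>R u = x + t *\<^sub>R u + t *\<^sub>R v" by simp
    then have "D = l \<bullet> (f (x + t *\<^sub>R v + t *\<^sub>R u) - f (x + t *\<^sub>R v) - f (x + t *\<^sub>R u) + f x)"
      unfolding D_def by (simp add: algebra_simps)
    then have "\<bar>D - t\<^sup>2 * (l \<bullet> f'' v u)\<bar> \<le> e/2 * t\<^sup>2" using d2(2) t by metis
    moreover have "\<bar>D - t\<^sup>2 * (l \<bullet> f'' u v)\<bar> \<le> e/2 * t\<^sup>2" using d1(2) t D_def by metis
    ultimately have "\<bar>t\<^sup>2 * (l \<bullet> f'' u v) - t\<^sup>2 * (l \<bullet> f'' v u)\<bar> \<le> t\<^sup>2 * e" by argo
    then have "t\<^sup>2 * \<bar>l \<bullet> f'' u v - l \<bullet> f'' v u\<bar> \<le> t\<^sup>2 * e"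
      by (simp add: right_diff_distrib[symmetric] abs_mult del: right_diff_distrib_numeral)
    then show ?thesis using t(1) by simp
  qed
  then have "\<bar>l \<bullet> f'' u v - l \<bullet> f'' v u\<bar> \<le> 0" by (rule field_le_epsilon)
  then have "l \<bullet> l = 0" by (simp add: l_def inner_diff_right)
  then show ?thesis by (simp add: l_def)
qed

text \<open>The mean value inequality for \<open>f - D a\<close> on a ball where the derivative is
  within \<open>e\<close> of \<open>D a\<close>. In finite dimension, continuity on basis vectors
  suffices for continuity in operator norm.\<close>

lemma has_derivative_strict:
  fixes f :: "'c::euclidean_space \<Rightarrow> 'd::euclidean_space"
  assumes f: "\<And>x. (f has_derivative D x) (at x)"
    and cont: "\<And>h. h \<in> Basis \<Longrightarrow> continuous_on UNIV (\<lambda>x. D x h)"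
    and "0 < e"
  obtains d where "0 < d"
    "\<And>x y. \<lbrakk>dist x a < d; dist y a < d\<rbrakk> \<Longrightarrow> norm (f x - f y - D a (x - y)) \<le> e * norm (x - y)"
proof -
  define B where "B x = Blinfun (D x)" for x
  have B: "blinfun_apply (B x) = D x" for x
    unfolding B_def using f[of x] has_derivative_bounded_linear bounded_linear_Blinfun_apply by blast
  have "continuous_on UNIV B"
    by (rule continuous_on_blinfun_componentwise) (use cont B in auto)
  then have "isCont B a" by (simp add: continuous_on_eq_continuous_at)
  then obtain d where d: "0 < d" "\<And>x. dist x a < d \<Longrightarrow> dist (B x) (B a) < e"
    using assms(3) unfolding continuous_at_eps_delta by metis
  show ?thesis
  proof (rule that[OF d(1)])
    fix x y assume xy: "dist x a < d" "dist y a < d"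
    have "norm ((f x - D a x) - (f y - D a y)) \<le> e * norm (x - y)"
    proof (rule differentiable_bound[of "ball a d" "\<lambda>x. f x - D a x" "\<lambda>x. (B x - B a)"])
      fix z assume z: "z \<in> ball a d"
      have "(D a has_derivative D a) (at z)"
        using f[of a] has_derivative_bounded_linear bounded_linear_imp_has_derivative by blast
      then have "((\<lambda>x. f x - D a x) has_derivative (\<lambda>h. D z h - D a h)) (at z)"
        by (intro has_derivative_diff f)
      then show "((\<lambda>x. f x - D a x) has_derivative blinfun_apply (B z - B a)) (at z within ball a d)"
        unfolding blinfun.diff_left[abs_def] B by (rule has_derivative_at_withinI)
      show "onorm (blinfun_apply (B z - B a)) \<le> e"
        using d(2)[of z] z by (simp add: dist_norm norm_blinfun.rep_eq[symmetric] norm_minus_commute[of a] less_imp_le)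
    qed (use xy in \<open>auto simp: dist_commute\<close>)
    moreover have "D a (x - y) = D a x - D a y"
      using linear_diff[OF has_derivative_linear[OF f]] .
    moreover have "f x - f y - (D a x - D a y) = (f x - D a x) - (f y - D a y)" by simp
    ultimately show "norm (f x - f y - D a (x - y)) \<le> e * norm (x - y)" by (simp only:)
  qed
qed

text \<open>Gathers what is used of smoothness: the joint derivative of the gradient in
  \<open>(x, l)\<close> splits into the Hessian of the Lagrangian and the adjoint Jacobian, and that
  Hessian is symmetric.\<close>

lemma gradL_derivative:
  fixes \<phi> :: "'a::euclidean_space \<Rightarrow> real" and \<Phi> :: "'a \<Rightarrow> 'b::euclidean_space"
  assumes "C2 \<phi>" "C2 \<Phi>"
  obtains D where
    "\<And>p. ((\<lambda>p. gradL \<phi> \<Phi> (fst p) (snd p)) has_derivative D p) (at p)"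
    "\<And>h. continuous_on UNIV (\<lambda>p. D p h)"
    "\<And>x l h \<mu>. D (x, l) (h, \<mu>) = frechet_derivative (\<lambda>x. gradL \<phi> \<Phi> x l) (at x) h
       + adjoint (frechet_derivative \<Phi> (at x)) \<mu>"
    "\<And>x l. linear (frechet_derivative (\<lambda>x. gradL \<phi> \<Phi> x l) (at x))"
    "\<And>x l v w. frechet_derivative (\<lambda>x. gradL \<phi> \<Phi> x l) (at x) v \<bullet> w
       = v \<bullet> frechet_derivative (\<lambda>x. gradL \<phi> \<Phi> x l) (at x) w"
proof -
  obtain \<phi>' \<phi>'' where phi: "\<And>x. (\<phi> has_derivative blinfun_apply (\<phi>' x)) (at x)"
    "\<And>x. (\<phi>' has_derivative blinfun_apply (\<phi>'' x)) (at x)" "continuous_on UNIV \<phi>''"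
    using assms(1) unfolding C2_def by blast
  obtain \<Phi>' \<Phi>'' where Phi: "\<And>x. (\<Phi> has_derivative blinfun_apply (\<Phi>' x)) (at x)"
    "\<And>x. (\<Phi>' has_derivative blinfun_apply (\<Phi>'' x)) (at x)" "continuous_on UNIV \<Phi>''"
    using assms(2) unfolding C2_def by blast
  have c1: "continuous_on UNIV \<Phi>'" 
    by (rule has_derivative_continuous_on[where f' = "\<lambda>x. blinfun_apply (\<Phi>'' x)"])
      (rule has_derivative_at_withinI[OF Phi(2)])
  have FPhi: "frechet_derivative \<Phi> (at x) = \<Phi>' x" for x
    using frechet_derivative_at[OF Phi(1)] by simp
  have gradL: "gradL \<phi> \<Phi> x l = (\<Sum>i\<in>Basis. (\<phi>' x i + l \<bullet> \<Phi>' x i) *\<^sub>R i)" for x l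
  proof -
    have "((\<lambda>z. \<phi> z + l \<bullet> \<Phi> z) has_derivative (\<lambda>h. \<phi>' x h + l \<bullet> \<Phi>' x h)) (at x)"
      by (intro has_derivative_add has_derivative_inner_right phi(1) Phi(1))
    then have "frechet_derivative (\<lambda>z. \<phi> z + l \<bullet> \<Phi> z) (at x) = (\<lambda>h. \<phi>' x h + l \<bullet> \<Phi>' x h)"
      using frechet_derivative_at by metis
    then show ?thesis by (simp add: gradL_def grad_def)
  qed
  define D where "D = (\<lambda>(x, l) (h, \<mu>). \<Sum>i\<in>Basis. (\<phi>'' x h i + l \<bullet> \<Phi>'' x h i + \<mu> \<bullet> \<Phi>' x i) *\<^sub>R i)"
  have Dapp: "D p h = (\<Sum>i\<in>Basis. (\<phi>'' (fst p) (fst h) i + snd p \<bullet> \<Phi>'' (fst p) (fst h) i + snd h \<bullet> \<Phi>' (fst p) i) *\<^sub>R i)" for p h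
    by (simp add: D_def case_prod_unfold)
  have app: "((\<lambda>p. \<phi>' (fst p) i) has_derivative (\<lambda>h. \<phi>'' (fst p) (fst h) i)) (at p)" for p :: "'a \<times> 'b" and i
  proof -
    have "((\<lambda>p. \<phi>' (fst p)) has_derivative (\<lambda>h. \<phi>'' (fst p) (fst h))) (at p)"
      by (rule has_derivative_compose[OF _ phi(2)]) (auto intro!: derivative_eq_intros)
    from blinfun.FDERIV[OF this has_derivative_const[of i]] show ?thesis by simp
  qed
  have appP: "((\<lambda>p. \<Phi>' (fst p) i) has_derivative (\<lambda>h. \<Phi>'' (fst p) (fst h) i)) (at p)" for p :: "'a \<times> 'b" and i
  proof -
    have "((\<lambda>p. \<Phi>' (fst p)) has_derivative (\<lambda>h. \<Phi>'' (fst p) (fst h))) (at p)"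
      by (rule has_derivative_compose[OF _ Phi(2)]) (auto intro!: derivative_eq_intros)
    from blinfun.FDERIV[OF this has_derivative_const[of i]] show ?thesis by simp
  qed
  have 1: "((\<lambda>p. gradL \<phi> \<Phi> (fst p) (snd p)) has_derivative D p) (at p)" for p
  proof -
    have "((\<lambda>p. gradL \<phi> \<Phi> (fst p) (snd p)) has_derivative
        (\<lambda>h. \<Sum>i\<in>Basis. (\<phi>'' (fst p) (fst h) i + (snd p \<bullet> \<Phi>'' (fst p) (fst h) i + snd h \<bullet> \<Phi>' (fst p) i)) *\<^sub>R i)) (at p)"
      unfolding gradL
      by (intro has_derivative_sum has_derivative_scaleR_left has_derivative_add app has_derivative_inner
          appP has_derivative_snd has_derivative_ident)
    moreover have "D p = (\<lambda>h. \<Sum>i\<in>Basis. (\<phi>'' (fst p) (fst h) i + (snd p \<bullet> \<Phi>'' (fst p) (fst h) i + snd h \<bullet> \<Phi>' (fst p) i)) *\<^sub>R i)"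
      by (rule ext) (simp add: Dapp add.assoc)
    ultimately show ?thesis by simp
  qed
  have 2: "continuous_on UNIV (\<lambda>p. D p h)" for h
    unfolding Dapp
    by (intro continuous_intros blinfun.continuous_on
        continuous_on_compose2[OF phi(3)] continuous_on_compose2[OF Phi(3)] continuous_on_compose2[OF c1]) auto
  define Hs where "Hs x l h = D (x, l) (h, 0)" for x l h
  have FH: "frechet_derivative (\<lambda>x. gradL \<phi> \<Phi> x l) (at x) = Hs x l" for x l
  proof -
    have "((\<lambda>x. (x, l)) has_derivative (\<lambda>h. (h, 0))) (at x)"
      by (intro has_derivative_Pair has_derivative_ident has_derivative_const)
    from has_derivative_compose[OF this 1]
    have "((\<lambda>x. gradL \<phi> \<Phi> x l) has_derivative Hs x l) (at x)" by (simp add: Hs_def[abs_def])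
    then show ?thesis using frechet_derivative_at by metis
  qed
  have adj: "adjoint (\<Phi>' x) \<mu> = (\<Sum>i\<in>Basis. (\<mu> \<bullet> \<Phi>' x i) *\<^sub>R i)" for x \<mu>
  proof -
    have "adjoint (\<Phi>' x) \<mu> = (\<Sum>i\<in>Basis. (adjoint (\<Phi>' x) \<mu> \<bullet> i) *\<^sub>R i)"
      by (simp add: euclidean_representation)
    also have "\<dots> = (\<Sum>i\<in>Basis. (\<mu> \<bullet> \<Phi>' x i) *\<^sub>R i)"
      using adjoint_works[OF bounded_linear.linear[OF blinfun.bounded_linear_right], of _ "\<Phi>' x" \<mu>]
      by (simp add: inner_commute)
    finally show ?thesis .
  qed
  have 3: "D (x, l) (h, \<mu>) = Hs x l h + adjoint (\<Phi>' x) \<mu>" for x l h \<mu>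
    unfolding Hs_def adj Dapp by (simp add: sum.distrib[symmetric] scaleR_add_left)
  have 4: "linear (Hs x l)" for x l
  proof -
    have "linear (D (x, l))" using has_derivative_linear[OF 1] .
    moreover have "linear (\<lambda>h::'a. (h, 0::'b))" by (auto intro!: linearI)
    ultimately show ?thesis unfolding Hs_def[abs_def] using linear_compose[unfolded o_def] by blast
  qed
  \<comment> \<open>Undoes the coordinates of \<open>grad\<close>: the Hessian becomes the bilinear
    form \<open>\<phi>'' + l \<bullet> \<Phi>''\<close>, whose summands are symmetric.\<close>
  have Hs_inner: "Hs x l v \<bullet> w = \<phi>'' x v w + l \<bullet> \<Phi>'' x v w" for x l v w
  proof -
    have "Hs x l v \<bullet> w = (\<Sum>i\<in>Basis. (\<phi>'' x v i + l \<bullet> \<Phi>'' x v i) * (i \<bullet> w))"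
      by (simp add: Hs_def Dapp inner_sum_left)
    also have "\<dots> = (\<Sum>i\<in>Basis. (w \<bullet> i) * \<phi>'' x v i) + l \<bullet> (\<Sum>i\<in>Basis. (w \<bullet> i) *\<^sub>R \<Phi>'' x v i)"
      by (simp add: inner_sum_right sum.distrib[symmetric] distrib_left distrib_right inner_commute mult.commute)
    also have "(\<Sum>i\<in>Basis. (w \<bullet> i) * \<phi>'' x v i) = \<phi>'' x v (\<Sum>i\<in>Basis. (w \<bullet> i) *\<^sub>R i)"
      by (simp add: blinfun.sum_right blinfun.scaleR_right)
    also have "(\<Sum>i\<in>Basis. (w \<bullet> i) *\<^sub>R \<Phi>'' x v i) = \<Phi>'' x v (\<Sum>i\<in>Basis. (w \<bullet> i) *\<^sub>R i)"
      by (simp add: blinfun.sum_right blinfun.scaleR_right)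
    finally show ?thesis by (simp add: euclidean_representation)
  qed
  have 5: "Hs x l v \<bullet> w = v \<bullet> Hs x l w" for x l v w
    unfolding Hs_inner inner_commute[of v]
    using second_derivative_symmetric[OF phi(1) phi(2)] second_derivative_symmetric[OF Phi(1) Phi(2)] by simp
  show ?thesis
    by (rule that[of D]) (use 1 2 3 4 5 FH FPhi in simp_all)
qed

section \<open>Metric regularity\<close>

text \<open>The values of \<open>F x\<close> need not be near \<open>yb\<close>. Those in
  \<open>V\<close> are handled by the Lipschitz localization; for the others
  \<open>dist y y'\<close> is bounded below by \<open>r / 2\<close>, which dominates a fixed bound
  on \<open>dist x (s y)\<close>.\<close>

lemma strongly_metrically_regular_imp_metrically_regular:
  fixes F :: "'a::metric_space \<Rightarrow> 'c::metric_space set"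
  assumes "strongly_metrically_regular F xb yb"
  shows "metrically_regular F xb yb"
proof -
  obtain U V s C where U: "open U" "xb \<in> U" and V: "open V" "yb \<in> V"
    and s: "\<And>y. y \<in> V \<Longrightarrow> inv_map F y \<inter> U = {s y}" and C: "C-lipschitz_on V s"
    using assms unfolding strongly_metrically_regular_def by blast
  have C0: "0 \<le> C" using C lipschitz_on_nonneg by blast
  obtain r where r: "0 < r" "ball yb r \<subseteq> V" using V openE by blast
  \<comment> \<open>Bounds \<open>dist x (s y)\<close> through \<open>xb\<close> and
    \<open>s yb\<close>; the definition does not force \<open>s yb = xb\<close>, hence the middle
    term. The summand 1 in \<open>\<kappa>\<close> makes it positive, as \<open>F x = {}\<close>
    requires a factor with product infinite.\<close>
  define K where "K = 1 + dist xb (s yb) + C * r"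
  define \<kappa> where "\<kappa> = C + 2 * K / r + 1"
  have K: "0 \<le> K" using C0 r by (simp add: K_def)
  have \<kappa>: "0 < \<kappa>" "C \<le> \<kappa>" "K \<le> \<kappa> * (r / 2)"
  proof -
    have "0 \<le> 2 * K / r" using K r by simp
    then show "0 < \<kappa>" "C \<le> \<kappa>" using C0 by (auto simp: \<kappa>_def)
    have "2 * K / r \<le> \<kappa>" using C0 by (simp add: \<kappa>_def)
    then show "K \<le> \<kappa> * (r / 2)" using r by (simp add: field_simps)
  qed
  have key: "dist x (s y) \<le> \<kappa> * dist y y'"
    if x: "x \<in> U" "dist x xb < 1" and y: "dist y yb < r / 2" and y': "y' \<in> F x" for x y y'
  proof (cases "y' \<in> V")
    case True
    have yV: "y \<in> V" using y r by (auto simp: dist_commute)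
    have "x \<in> inv_map F y' \<inter> U" using x(1) y' by (simp add: inv_map_def)
    then have "x = s y'" using s[OF True] by blast
    then have "dist x (s y) \<le> C * dist y y'" using lipschitz_onD[OF C True yV] by (simp add: dist_commute)
    also have "\<dots> \<le> \<kappa> * dist y y'" using \<kappa>(2) by (simp add: mult_right_mono)
    finally show ?thesis .
  next
    case False
    have yV: "y \<in> V" using y r by (auto simp: dist_commute)
    have "y' \<notin> ball yb r" using False r(2) by blast
    then have "r \<le> dist yb y'" by simp
    then have "r / 2 \<le> dist y y'" using y dist_triangle[of yb y' y] by (simp add: dist_commute)
    have "dist (s yb) (s y) \<le> C * dist yb y" using lipschitz_onD[OF C V(2) yV] .
    also have "\<dots> \<le> C * r" using C0 y r(1) by (intro mult_left_mono) (auto simp: dist_commute)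
    finally have "dist x (s y) \<le> K"
      using dist_triangle[of x "s y" xb] dist_triangle[of xb "s y" "s yb"] x(2) by (simp add: K_def)
    also have "\<dots> \<le> \<kappa> * (r / 2)" by fact
    also have "\<dots> \<le> \<kappa> * dist y y'" using \<open>r / 2 \<le> dist y y'\<close> \<kappa>(1) by (intro mult_left_mono) auto
    finally show ?thesis .
  qed
  have "setdist x (inv_map F y) \<le> ereal \<kappa> * setdist y (F x)"
    if x: "x \<in> U \<inter> ball xb 1" and y: "y \<in> ball yb (r / 2)" for x y
  proof -
    have "y \<in> V" using y r by auto
    then have sy: "s y \<in> inv_map F y" using s by blast
    then have left: "setdist x (inv_map F y) \<le> ereal (dist x (s y))"
      by (auto simp: setdist_def intro: infdist_le)
    show ?thesis
    proof (cases "F x = {}")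
      case True
      then show ?thesis using \<kappa>(1) by (simp add: setdist_def)
    next
      case False
      have "dist x xb < 1" "dist y yb < r / 2" using x y by (auto simp: dist_commute)
      then have "dist x (s y) \<le> \<kappa> * dist y y'" if "y' \<in> F x" for y'
        using key[OF _ _ _ that] x by blast
      then have "dist x (s y) / \<kappa> \<le> dist y y'" if "y' \<in> F x" for y'
        using \<kappa>(1) that by (simp add: pos_divide_le_eq mult.commute)
      then have "dist x (s y) / \<kappa> \<le> infdist y (F x)"
        unfolding infdist_notempty[OF False] using False by (intro cINF_greatest) auto
      then have "dist x (s y) \<le> \<kappa> * infdist y (F x)" using \<kappa>(1) by (simp add: pos_divide_le_eq mult.commute)
      then have "ereal (dist x (s y)) \<le> ereal \<kappa> * setdist y (F x)" using False by (simp add: setdist_def)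
      then show ?thesis using left order_trans by blast
    qed
  qed
  then show ?thesis
    unfolding metrically_regular_def using \<kappa>(1) U V r(1)
    by (intro exI[of _ \<kappa>] exI[of _ "U \<inter> ball xb 1"] exI[of _ "ball yb (r / 2)"]) auto
qed

text \<open>An actual preimage instead of a distance. The infimum need not be attained, so the
  constant grows from \<open>\<kappa>\<close> to \<open>\<kappa> + 1\<close>; when
  \<open>y = y'\<close> there is no slack, and \<open>x\<close> itself serves.\<close>

lemma metrically_regularE:
  fixes F :: "'a::metric_space \<Rightarrow> 'c::metric_space set"
  assumes "metrically_regular F xb yb"
  obtains \<kappa> e where "0 < \<kappa>" "0 < e"
    "\<And>x y y'. \<lbrakk>dist x xb < e; dist y yb < e; y' \<in> F x\<rbrakk> \<Longrightarrow> \<exists>x'. y \<in> F x' \<and> dist x x' \<le> \<kappa> * dist y y'"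
proof -
  obtain \<kappa> U V where \<kappa>: "0 \<le> \<kappa>" and U: "open U" "xb \<in> U" and V: "open V" "yb \<in> V"
    and reg: "\<And>x y. \<lbrakk>x \<in> U; y \<in> V\<rbrakk> \<Longrightarrow> setdist x (inv_map F y) \<le> ereal \<kappa> * setdist y (F x)"
    using assms unfolding metrically_regular_def by blast
  obtain e1 where e1: "0 < e1" "ball xb e1 \<subseteq> U" using U openE by blast
  obtain e2 where e2: "0 < e2" "ball yb e2 \<subseteq> V" using V openE by blast
  show ?thesis
  proof (rule that[of "\<kappa> + 1" "min e1 e2"])
    fix x y y' assume x: "dist x xb < min e1 e2" and y: "dist y yb < min e1 e2" and y': "y' \<in> F x"
    show "\<exists>x'. y \<in> F x' \<and> dist x x' \<le> (\<kappa> + 1) * dist y y'"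
    proof (cases "y = y'")
      case True
      then show ?thesis using y' by (intro exI[of _ x]) auto
    next
      case False
      have xU: "x \<in> U" and yV: "y \<in> V" using x y e1(2) e2(2) by (auto simp: dist_commute)
      have "setdist x (inv_map F y) \<le> ereal \<kappa> * setdist y (F x)" using reg[OF xU yV] .
      also have "setdist y (F x) = ereal (infdist y (F x))" using y' by (auto simp: setdist_def)
      also have "ereal \<kappa> * ereal (infdist y (F x)) \<le> ereal (\<kappa> * dist y y')"
        using \<kappa> infdist_le[OF y'] by (simp add: mult_left_mono)
      finally have le: "setdist x (inv_map F y) \<le> ereal (\<kappa> * dist y y')" .
      then have ne: "inv_map F y \<noteq> {}" by (auto simp: setdist_def)
      then have "infdist x (inv_map F y) \<le> \<kappa> * dist y y'" using le by (simp add: setdist_def)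
      also have "\<dots> < (\<kappa> + 1) * dist y y'" using False by (simp add: distrib_right)
      finally have "(INF a\<in>inv_map F y. dist x a) < (\<kappa> + 1) * dist y y'"
        unfolding infdist_notempty[OF ne] .
      from cInf_lessD[OF _ this] ne
      obtain x' where "x' \<in> inv_map F y" "dist x x' < (\<kappa> + 1) * dist y y'" by auto
      then show ?thesis by (auto simp: inv_map_def intro!: exI[of _ x'])
    qed
  qed (use \<kappa> e1 e2 in auto)
qed

section \<open>Necessity of the coderivative condition\<close>

lemma has_derivative_sequentially:
  fixes f :: "'c::real_normed_vector \<Rightarrow> 'd::real_normed_vector"
  assumes f: "(f has_derivative D) (at p)"
    and t: "\<And>j. 0 < t j" "t \<longlonglongrightarrow> (0::real)" and Q: "Q \<longlonglongrightarrow> q"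
  shows "(\<lambda>j. (1 / t j) *\<^sub>R (f (p + t j *\<^sub>R Q j) - f p)) \<longlonglongrightarrow> D q"
proof -
  have bl: "bounded_linear D" using f has_derivative_bounded_linear by blast
  have lim: "(\<lambda>j. t j *\<^sub>R Q j) \<longlonglongrightarrow> 0" using tendsto_scaleR[OF t(2) Q] by simp
  have bnd: "Bseq Q" using Q convergent_imp_Bseq convergentI by blast
  then obtain M where M: "0 < M" "\<And>j. norm (Q j) \<le> M" using BseqE by metis
  have "(\<lambda>j. (1 / t j) *\<^sub>R (f (p + t j *\<^sub>R Q j) - f p) - D (Q j)) \<longlonglongrightarrow> 0"
  proof (rule tendstoI)
    fix e :: real assume "0 < e"
    define e' where "e' = e / (2 * M)"
    have e': "0 < e'" using \<open>0 < e\<close> M by (simp add: e'_def)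
    obtain d where d: "0 < d"
      "\<And>y. norm (y - p) < d \<Longrightarrow> norm (f y - f p - D (y - p)) \<le> e' * norm (y - p)"
      using f[unfolded has_derivative_at_alt] e' by blast
    have "eventually (\<lambda>j. dist (t j *\<^sub>R Q j) 0 < d) sequentially" using tendstoD[OF lim d(1)] .
    then show "eventually (\<lambda>j. dist ((1 / t j) *\<^sub>R (f (p + t j *\<^sub>R Q j) - f p) - D (Q j)) 0 < e) sequentially"
    proof eventually_elim
      case (elim j)
      have "norm (f (p + t j *\<^sub>R Q j) - f p - D (t j *\<^sub>R Q j)) \<le> e' * norm (t j *\<^sub>R Q j)"
        using d(2)[of "p + t j *\<^sub>R Q j"] elim by simp
      also have "\<dots> \<le> e' * (t j * M)"
        using M(2)[of j] t(1)[of j] e' by (intro mult_left_mono) (auto intro: mult_left_mono)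
      also have "\<dots> = t j * (e / 2)" using M(1) by (simp add: e'_def)
      finally have *: "norm (f (p + t j *\<^sub>R Q j) - f p - D (t j *\<^sub>R Q j)) \<le> t j * (e / 2)" .
      have "(1 / t j) *\<^sub>R (f (p + t j *\<^sub>R Q j) - f p) - D (Q j)
          = (1 / t j) *\<^sub>R (f (p + t j *\<^sub>R Q j) - f p - D (t j *\<^sub>R Q j))"
        using t(1)[of j] linear_scale[OF bounded_linear.linear[OF bl], of "t j" "Q j"]
        by (simp add: scaleR_diff_right)
      then have "norm ((1 / t j) *\<^sub>R (f (p + t j *\<^sub>R Q j) - f p) - D (Q j)) \<le> e / 2"
        using * t(1)[of j] by (simp add: pos_divide_le_eq mult.commute)
      then show ?case using \<open>0 < e\<close> by simp
    qed
  qed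
  from tendsto_add[OF this bounded_linear.tendsto[OF bl Q]] show ?thesis by simp
qed

text \<open>Expanding the direction in a basis reduces joint convergence to finitely many fixed
  directions.\<close>

lemma derivative_jointly_continuous_sequentially:
  fixes D :: "'c::topological_space \<Rightarrow> 'd::euclidean_space \<Rightarrow> 'e::real_normed_vector"
  assumes lin: "\<And>p. linear (D p)" and cont: "\<And>h. continuous_on UNIV (\<lambda>p. D p h)"
    and "P \<longlonglongrightarrow> p" "Q \<longlonglongrightarrow> q"
  shows "(\<lambda>k. D (P k) (Q k)) \<longlonglongrightarrow> D p q"
proof -
  have expand: "D p h = (\<Sum>b\<in>Basis. (h \<bullet> b) *\<^sub>R D p b)" for p h
  proof -
    have "D p h = D p (\<Sum>b\<in>Basis. (h \<bullet> b) *\<^sub>R b)" by (simp add: euclidean_representation)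
    then show ?thesis by (simp add: linear_sum[OF lin] linear_scale[OF lin])
  qed
  have "(\<lambda>k. D (P k) b) \<longlonglongrightarrow> D p b" for b
    using continuous_on_tendsto_compose[OF cont assms(3)] by simp
  then have "(\<lambda>k. \<Sum>b\<in>Basis. (Q k \<bullet> b) *\<^sub>R D (P k) b) \<longlonglongrightarrow> (\<Sum>b\<in>Basis. (q \<bullet> b) *\<^sub>R D p b)"
    by (intro tendsto_sum tendsto_scaleR tendsto_inner assms(4) tendsto_const)
  moreover have "(\<lambda>k. D (P k) (Q k)) = (\<lambda>k. \<Sum>b\<in>Basis. (Q k \<bullet> b) *\<^sub>R D (P k) b)"
    by (rule ext) (rule expand)
  ultimately show ?thesis using expand[of p q] by (simp only:)
qed

text \<open>Moving the right-hand side by \<open>t j *\<^sub>R (d, d')\<close> moves a solution by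
  at most \<open>\<kappa>\<close> times as much, so the difference quotients are bounded and a limit
  \<open>Q\<close> exists. It solves the linearised first equation, and
  \<open>(J (fst Q) + d', snd Q)\<close> is tangent to the graph. The bound on \<open>Q\<close> does
  not depend on the base point, which allows a later passage to the limit.\<close>

lemma tangent_direction_of_regularity:
  fixes f :: "'a::euclidean_space \<times> 'b::euclidean_space \<Rightarrow> 'a" and \<Phi> :: "'a \<Rightarrow> 'b"
  assumes f: "(f has_derivative D) (at (x, l))" and Phi: "(\<Phi> has_derivative J) (at x)"
    and "0 < \<kappa>" "0 < e" "dist (f (x, l), z - \<Phi> x) 0 < e"
    and reg: "\<And>a b. dist (a, b) 0 < e \<Longrightarrow> \<exists>X. f X = a \<and> (b + \<Phi> (fst X), snd X) \<in> R \<and>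
        dist (x, l) X \<le> \<kappa> * dist (a, b) (f (x, l), z - \<Phi> x)"
    and pq: "(p, q) \<in> frechet_normal R (z, l)"
  obtains Q where "norm Q \<le> \<kappa> * norm (d, d')" "D Q = d" "p \<bullet> (J (fst Q) + d') + q \<bullet> snd Q \<le> 0"
proof -
  define y0 where "y0 = (f (x, l), z - \<Phi> x)"
  \<comment> \<open>Slack between the unperturbed right-hand side and radius \<open>e\<close>; the
    steps \<open>t j\<close> are scaled to stay within it.\<close>
  define g where "g = e - dist y0 0"
  have g: "0 < g" using assms(5) by (simp add: g_def y0_def)
  define t where "t j = g / (norm (d, d') + 1) * (1 / real (Suc j))" for j
  have npos: "0 < norm (d, d') + 1" by (simp add: add_nonneg_pos)
  have t0: "0 < t j" for j using g npos by (simp add: t_def)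
  have "t \<longlonglongrightarrow> g / (norm (d, d') + 1) * 0"
    unfolding t_def by (intro tendsto_intros lim_1_over_n[THEN filterlim_compose[OF _ filterlim_Suc]])
  then have tlim: "t \<longlonglongrightarrow> 0" by simp
  have nrm: "norm (t j *\<^sub>R (d, d')) = t j * norm (d, d')" for j
    unfolding norm_scaleR using t0[of j] by simp
  have tsmall: "dist (y0 + t j *\<^sub>R (d, d')) 0 < e" for j
  proof -
    have "t j \<le> g / (norm (d, d') + 1)"
      unfolding t_def using g npos by (intro mult_left_le) auto
    then have "t j * (norm (d, d') + 1) \<le> g" using npos by (simp add: pos_le_divide_eq)
    then have "t j * norm (d, d') < g" using t0[of j] by (simp add: distrib_left)
    then show ?thesis
      using norm_triangle_ineq[of y0 "t j *\<^sub>R (d, d')"]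
      unfolding nrm g_def dist_norm diff_0_right by linarith
  qed
  have y: "y0 + t j *\<^sub>R (d, d') = (f (x, l) + t j *\<^sub>R d, z - \<Phi> x + t j *\<^sub>R d')" for j
    by (simp add: y0_def)
  have "\<exists>X. f X = f (x, l) + t j *\<^sub>R d \<and> (z - \<Phi> x + t j *\<^sub>R d' + \<Phi> (fst X), snd X) \<in> R \<and>
      dist (x, l) X \<le> \<kappa> * (t j * norm (d, d'))" for j
  proof -
    have "dist (y0 + t j *\<^sub>R (d, d')) y0 = t j * norm (d, d')"
      unfolding dist_norm add_diff_cancel_left' nrm ..
    then show ?thesis
      using reg[of "f (x, l) + t j *\<^sub>R d" "z - \<Phi> x + t j *\<^sub>R d'"] tsmall[of j]
      unfolding y y0_def[symmetric] by simp
  qed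
  then obtain X where X: "\<And>j. f (X j) = f (x, l) + t j *\<^sub>R d"
    "\<And>j. (z - \<Phi> x + t j *\<^sub>R d' + \<Phi> (fst (X j)), snd (X j)) \<in> R"
    "\<And>j. dist (x, l) (X j) \<le> \<kappa> * (t j * norm (d, d'))" by metis
  define Qs where "Qs j = (1 / t j) *\<^sub>R (X j - (x, l))" for j
  have XQ: "X j = (x, l) + t j *\<^sub>R Qs j" for j using t0[of j] by (simp add: Qs_def)
  have Qb: "norm (Qs j) \<le> \<kappa> * norm (d, d')" for j
  proof -
    have "norm (X j - (x, l)) \<le> t j * (\<kappa> * norm (d, d'))"
      using X(3)[of j] by (simp add: dist_norm norm_minus_commute mult.left_commute)
    then show ?thesis using t0[of j] by (simp add: Qs_def pos_divide_le_eq mult.commute)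
  qed
  have "compact (cball (0 :: 'a \<times> 'b) (\<kappa> * norm (d, d')))" by simp
  moreover have "\<forall>j. Qs j \<in> cball 0 (\<kappa> * norm (d, d'))" using Qb by simp
  ultimately obtain Q \<rho> where Q: "Q \<in> cball 0 (\<kappa> * norm (d, d'))" "strict_mono \<rho>" "(Qs \<circ> \<rho>) \<longlonglongrightarrow> Q"
    unfolding compact_def by blast
  have trho: "(\<lambda>j. t (\<rho> j)) \<longlonglongrightarrow> 0" using LIMSEQ_subseq_LIMSEQ[OF tlim Q(2)] by (simp add: o_def)
  have Qrho: "(\<lambda>j. Qs (\<rho> j)) \<longlonglongrightarrow> Q" using Q(3) by (simp add: o_def)
  have "(\<lambda>j. (1 / t (\<rho> j)) *\<^sub>R (f ((x, l) + t (\<rho> j) *\<^sub>R Qs (\<rho> j)) - f (x, l))) \<longlonglongrightarrow> D Q"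
    by (rule has_derivative_sequentially[OF f t0 trho Qrho])
  moreover have "(1 / t (\<rho> j)) *\<^sub>R (f ((x, l) + t (\<rho> j) *\<^sub>R Qs (\<rho> j)) - f (x, l)) = d" for j
    unfolding XQ[symmetric] X(1) using t0[of "\<rho> j"] by simp
  ultimately have "(\<lambda>j. d) \<longlonglongrightarrow> D Q" by simp
  then have DQ: "D Q = d" by (rule LIMSEQ_unique[OF _ tendsto_const])
  define E where "E j = (1 / t (\<rho> j)) *\<^sub>R (\<Phi> (x + t (\<rho> j) *\<^sub>R fst (Qs (\<rho> j))) - \<Phi> x)" for j
  have E: "E \<longlonglongrightarrow> J (fst Q)"
    unfolding E_def by (rule has_derivative_sequentially[OF Phi t0 trho tendsto_fst[OF Qrho]])
  have "(J (fst Q) + d', snd Q) \<in> tangent_cone R (z, l)"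
    unfolding tangent_cone_def
  proof (intro CollectI exI conjI allI)
    show "0 < t (\<rho> j)" for j using t0 .
    show "(\<lambda>j. t (\<rho> j)) \<longlonglongrightarrow> 0" by fact
    show "(\<lambda>j. (E j + d', snd (Qs (\<rho> j)))) \<longlonglongrightarrow> (J (fst Q) + d', snd Q)"
      by (intro tendsto_intros E tendsto_snd[OF Qrho])
    fix j
    have "fst (X (\<rho> j)) = x + t (\<rho> j) *\<^sub>R fst (Qs (\<rho> j))" "snd (X (\<rho> j)) = l + t (\<rho> j) *\<^sub>R snd (Qs (\<rho> j))"
      unfolding XQ by simp_all
    then have "(z, l) + t (\<rho> j) *\<^sub>R (E j + d', snd (Qs (\<rho> j)))
        = (z - \<Phi> x + t (\<rho> j) *\<^sub>R d' + \<Phi> (fst (X (\<rho> j))), snd (X (\<rho> j)))"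
      using t0[of "\<rho> j"] by (simp add: E_def scaleR_add_right)
    then show "(z, l) + t (\<rho> j) *\<^sub>R (E j + d', snd (Qs (\<rho> j))) \<in> R" using X(2) by (simp only:)
  qed
  then have "(p, q) \<bullet> (J (fst Q) + d', snd Q) \<le> 0" using pq unfolding frechet_normal_def by blast
  then show ?thesis using that[of Q] Q(1) DQ by simp
qed

text \<open>The directions \<open>Q\<close> obtained for the right-hand side
  \<open>(- w, w')\<close> at approximating graph points converge along a subsequence; the limiting
  normal inequality, together with the linearised equation for \<open>Q\<close>, contradicts a
  nonzero \<open>(w, w')\<close>.\<close>

lemma coderivative_condition_necessary:
  fixes f :: "'a::euclidean_space \<times> 'b::euclidean_space \<Rightarrow> 'a" and \<Phi> :: "'a \<Rightarrow> 'b"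
  assumes f: "\<And>p. (f has_derivative D p) (at p)" and contD: "\<And>h. continuous_on UNIV (\<lambda>p. D p h)"
    and DH: "\<And>h \<mu>. D (xb, lb) (h, \<mu>) = H h + adjoint J \<mu>"
    and H: "\<And>v w. H v \<bullet> w = v \<bullet> H w"
    and Phi: "(\<Phi> has_derivative J) (at xb)" and f0: "f (xb, lb) = 0"
    and pos: "0 < \<kappa>" "0 < e"
    and reg: "\<And>x l z a b. \<lbrakk>dist (x, l) (xb, lb) < e; dist (a, b) 0 < e; (z, l) \<in> R\<rbrakk> \<Longrightarrow>
        \<exists>X. f X = a \<and> (b + \<Phi> (fst X), snd X) \<in> R \<and>
        dist (x, l) X \<le> \<kappa> * dist (a, b) (f (x, l), z - \<Phi> x)"
    and w: "H w + adjoint J w' = 0" "(w', - J w) \<in> limiting_normal R (\<Phi> xb, lb)"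
  shows "w = 0 \<and> w' = 0"
proof -
  obtain zl pq where zl: "\<And>k. zl k \<in> R" "zl \<longlonglongrightarrow> (\<Phi> xb, lb)" "pq \<longlonglongrightarrow> (w', - J w)"
    "\<And>k. pq k \<in> frechet_normal R (zl k)"
    using w(2) unfolding limiting_normal_def by blast
  define z where "z k = fst (zl k)" for k
  define l where "l k = snd (zl k)" for k
  define p where "p k = fst (pq k)" for k
  define q where "q k = snd (pq k)" for k
  have zlim: "z \<longlonglongrightarrow> \<Phi> xb" and llim: "l \<longlonglongrightarrow> lb"
    unfolding z_def l_def using tendsto_fst[OF zl(2)] tendsto_snd[OF zl(2)] by simp_all
  have plim: "p \<longlonglongrightarrow> w'" and qlim: "q \<longlonglongrightarrow> - J w"
    unfolding p_def q_def using tendsto_fst[OF zl(3)] tendsto_snd[OF zl(3)] by simp_all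
  have mem: "(z k, l k) \<in> R" "(p k, q k) \<in> frechet_normal R (z k, l k)" for k
    using zl(1,4)[of k] by (simp_all add: z_def l_def p_def q_def)
  \<comment> \<open>The primal point stays at \<open>xb\<close>: the discrepancy between
    \<open>z k\<close> and \<open>\<Phi> xb\<close> is absorbed by the right-hand side, which still
    tends to zero.\<close>
  have xl: "(\<lambda>k. (xb, l k)) \<longlonglongrightarrow> (xb, lb)" by (intro tendsto_intros llim)
  have "continuous_on UNIV f"
    using f by (meson continuous_at_imp_continuous_on has_derivative_continuous)
  then have "(\<lambda>k. f (xb, l k)) \<longlonglongrightarrow> 0"
    using continuous_on_tendsto_compose[OF _ xl] f0 by fastforce
  then have "(\<lambda>k. (f (xb, l k), z k - \<Phi> xb)) \<longlonglongrightarrow> (0, \<Phi> xb - \<Phi> xb)"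
    by (intro tendsto_intros zlim)
  then have ylim: "(\<lambda>k. (f (xb, l k), z k - \<Phi> xb)) \<longlonglongrightarrow> 0" by (simp add: zero_prod_def)
  have "eventually (\<lambda>k. dist (xb, l k) (xb, lb) < e \<and> dist (f (xb, l k), z k - \<Phi> xb) 0 < e) sequentially"
    using tendstoD[OF xl pos(2)] tendstoD[OF ylim pos(2)] by eventually_elim simp
  then obtain K where K: "\<And>k. k \<ge> K \<Longrightarrow> dist (xb, l k) (xb, lb) < e"
    "\<And>k. k \<ge> K \<Longrightarrow> dist (f (xb, l k), z k - \<Phi> xb) 0 < e"
    unfolding eventually_sequentially by blast
  define C where "C = \<kappa> * norm (- w, w')"
  have "\<exists>Q. norm Q \<le> C \<and> D (xb, l (k + K)) Q = - w \<and>
      p (k + K) \<bullet> (J (fst Q) + w') + q (k + K) \<bullet> snd Q \<le> 0" for k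
  proof -
    have "K \<le> k + K" by simp
    show ?thesis
      using tangent_direction_of_regularity[OF f Phi pos K(2)[OF \<open>K \<le> k + K\<close>]
          reg[OF K(1)[OF \<open>K \<le> k + K\<close>] _ mem(1)] mem(2), of "- w" w']
      unfolding C_def by metis
  qed
  then obtain Qs where Qs: "\<And>k. norm (Qs k) \<le> C" "\<And>k. D (xb, l (k + K)) (Qs k) = - w"
    "\<And>k. p (k + K) \<bullet> (J (fst (Qs k)) + w') + q (k + K) \<bullet> snd (Qs k) \<le> 0" by metis
  have "compact (cball (0 :: 'a \<times> 'b) C)" by simp
  moreover have "\<forall>j. Qs j \<in> cball 0 C" using Qs(1) by simp
  ultimately obtain Q \<rho> where Q: "strict_mono \<rho>" "(Qs \<circ> \<rho>) \<longlonglongrightarrow> Q"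
    unfolding compact_def by blast
  have Qrho: "(\<lambda>j. Qs (\<rho> j)) \<longlonglongrightarrow> Q" using Q(2) by (simp add: o_def)
  have shift: "(\<lambda>j. u (\<rho> j + K)) \<longlonglongrightarrow> v" if "u \<longlonglongrightarrow> v" for u :: "nat \<Rightarrow> 'd::topological_space" and v
    using LIMSEQ_subseq_LIMSEQ[OF LIMSEQ_ignore_initial_segment[OF that, of K] Q(1)] by (simp add: o_def)
  have linD: "linear (D p)" for p using has_derivative_linear[OF f] .
  have "(\<lambda>j. D (xb, l (\<rho> j + K)) (Qs (\<rho> j))) \<longlonglongrightarrow> D (xb, lb) Q"
    by (rule derivative_jointly_continuous_sequentially[OF linD contD shift[OF xl] Qrho])
  then have "(\<lambda>j. - w) \<longlonglongrightarrow> D (xb, lb) Q" unfolding Qs(2) .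
  then have DQ: "D (xb, lb) Q = - w" by (rule LIMSEQ_unique[OF _ tendsto_const])
  have blJ: "bounded_linear J" using Phi has_derivative_bounded_linear by blast
  then have linJ: "linear J" using bounded_linear.linear by blast
  have "(\<lambda>j. p (\<rho> j + K) \<bullet> (J (fst (Qs (\<rho> j))) + w') + q (\<rho> j + K) \<bullet> snd (Qs (\<rho> j)))
      \<longlonglongrightarrow> w' \<bullet> (J (fst Q) + w') + (- J w) \<bullet> snd Q"
    by (intro tendsto_intros shift[OF plim] shift[OF qlim] bounded_linear.tendsto[OF blJ]
        tendsto_fst[OF Qrho] tendsto_snd[OF Qrho])
  then have le: "w' \<bullet> (J (fst Q) + w') + (- J w) \<bullet> snd Q \<le> 0"
    using Qs(3) by (intro tendsto_upperbound) (auto intro: always_eventually)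
  have eq: "H (fst Q) + adjoint J (snd Q) = - w" using DQ DH[of "fst Q" "snd Q"] by simp
  have "w' \<bullet> J (fst Q) = fst Q \<bullet> adjoint J w'" using adjoint_works[OF linJ] by (simp add: inner_commute)
  also have "\<dots> = - (fst Q \<bullet> H w)" using w(1) by (simp add: add_eq_0_iff2)
  also have "\<dots> = - (H (fst Q) \<bullet> w)" using H by simp
  finally have 1: "w' \<bullet> J (fst Q) = - (H (fst Q) \<bullet> w)" .
  have "J w \<bullet> snd Q = w \<bullet> adjoint J (snd Q)" using adjoint_works[OF linJ] by simp
  also have "\<dots> = w \<bullet> (- w - H (fst Q))" using eq by (metis add_diff_cancel_left')
  finally have 2: "J w \<bullet> snd Q = - (w \<bullet> w) - H (fst Q) \<bullet> w" by (simp add: inner_diff_right inner_commute)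
  \<comment> \<open>The terms \<open>H (fst Q) \<bullet> w\<close> in \<open>1\<close> and
    \<open>2\<close> cancel, by symmetry of \<open>H\<close>.\<close>
  have "w' \<bullet> w' + w \<bullet> w \<le> 0" using le 1 2 by (simp add: inner_add_right)
  then have "w' \<bullet> w' = 0 \<and> w \<bullet> w = 0" using inner_ge_zero[of w] inner_ge_zero[of w'] by linarith
  then show ?thesis by simp
qed

section \<open>Strong regularity\<close>

text \<open>Near the reference point, \<open>z - z'\<close> lies in the span of the whole face,
  \<open>l - l'\<close> annihilates \<open>L\<close>, and monotonicity supplies the sign. These are
  the constraints of \<open>homogeneous_lower_bound\<close>, so only linearisation errors
  remain.\<close>

lemma generalized_equation_estimate:
  fixes f :: "'a::euclidean_space \<times> 'b::euclidean_space \<Rightarrow> 'a" and \<Phi> :: "'a \<Rightarrow> 'b"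
  assumes E: "polyhedron E" and zl: "(\<Phi> xb, lb) \<in> subgradient_rel E"
    and f: "\<And>p. (f has_derivative D p) (at p)" and contD: "\<And>h. continuous_on UNIV (\<lambda>p. D p h)"
    and DH: "\<And>h \<mu>. D (xb, lb) (h, \<mu>) = H h + adjoint J \<mu>"
    and H: "linear H" "\<And>v w. H v \<bullet> w = v \<bullet> H w" and J: "linear J"
    and Phi: "\<And>e. 0 < e \<Longrightarrow> \<exists>d>0. \<forall>x y. dist x xb < d \<longrightarrow> dist y xb < d \<longrightarrow>
        norm (\<Phi> x - \<Phi> y - J (x - y)) \<le> e * norm (x - y)"
    and cond: "\<And>w w'. \<lbrakk>H w + adjoint J w' = 0; (w', - J w) \<in> limiting_normal (subgradient_rel E) (\<Phi> xb, lb)\<rbrakk>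
        \<Longrightarrow> w = 0 \<and> w' = 0"
  obtains \<delta> c where "0 < \<delta>" "0 < c"
    "\<And>x l z x' l' z'. \<lbrakk>dist x xb < \<delta>; dist x' xb < \<delta>; dist l lb < \<delta>; dist l' lb < \<delta>;
        dist z (\<Phi> xb) < \<delta>; dist z' (\<Phi> xb) < \<delta>;
        (z, l) \<in> subgradient_rel E; (z', l') \<in> subgradient_rel E\<rbrakk> \<Longrightarrow>
        norm (x - x', l - l', z - z') \<le> c * norm (f (x, l) - f (x', l'), (z - \<Phi> x) - (z' - \<Phi> x'))"
proof -
  define F where "F = conj_face E lb"
  define S where "S = span ((\<lambda>x. x - \<Phi> xb) ` F)"
  have zF: "\<Phi> xb \<in> F" using zl by (simp add: F_def mem_conj_face)
  have face: "F face_of conj_face E lb"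
    unfolding F_def using polyhedron_conj_face[OF E] polyhedron_imp_convex face_of_refl by blast
  obtain L where L: "\<And>l v. \<lbrakk>(\<Phi> xb, l) \<in> subgradient_rel E; v \<in> L\<rbrakk> \<Longrightarrow> (l - lb) \<bullet> v = 0"
    "\<And>w w'. \<lbrakk>H w + adjoint J w' = 0; J w \<in> S; \<And>v. v \<in> L \<Longrightarrow> w' \<bullet> v = 0; 0 \<le> J w \<bullet> w'\<rbrakk> \<Longrightarrow> w = 0 \<and> w' = 0"
    using coderivative_condition_face[OF E H J cond face zF] unfolding S_def by (metis (no_types, lifting))
  have subS: "subspace S" by (simp add: S_def)
  obtain m where m: "0 < m"
    "\<forall>w w' s. s \<in> S \<longrightarrow> (\<forall>v\<in>L. w' \<bullet> v = 0) \<longrightarrow> 0 \<le> s \<bullet> w' \<longrightarrow>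
      m * norm (w, w', s) \<le> norm (H w + adjoint J w') + norm (s - J w)"
    using homogeneous_lower_bound[of H J S L] H(1) J subS L(2) by blast
  \<comment> \<open>Two linearisation errors of size \<open>m / 4 * K\<close> leave half of
    \<open>m * K\<close> on the left; bounding the sum of the two residual norms by twice the norm
    of the pair gives the constant \<open>4 / m\<close>.\<close>
  have m4: "0 < m / 4" using m(1) by simp
  obtain e1 where e1: "0 < e1"
    "\<And>z l. \<lbrakk>(z, l) \<in> subgradient_rel E; dist z (\<Phi> xb) < e1\<rbrakk> \<Longrightarrow> (\<Phi> xb, l) \<in> subgradient_rel E"
    "\<And>z l. \<lbrakk>(z, l) \<in> subgradient_rel E; dist l lb < e1\<rbrakk> \<Longrightarrow> (z, lb) \<in> subgradient_rel E"
    using subgradient_rel_local[OF E, of "\<Phi> xb" lb] by metis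
  obtain e2 where e2: "0 < e2"
    "\<And>p q. \<lbrakk>dist p (xb, lb) < e2; dist q (xb, lb) < e2\<rbrakk> \<Longrightarrow>
      norm (f p - f q - D (xb, lb) (p - q)) \<le> m / 4 * norm (p - q)"
    using has_derivative_strict[OF f contD m4, of "(xb, lb)"] by metis
  obtain e3 where e3: "0 < e3"
    "\<And>x y. \<lbrakk>dist x xb < e3; dist y xb < e3\<rbrakk> \<Longrightarrow> norm (\<Phi> x - \<Phi> y - J (x - y)) \<le> m / 4 * norm (x - y)"
    using Phi[OF m4] by metis
  define \<delta> where "\<delta> = min e1 (min (e2 / 2) e3)"
  have \<delta>: "0 < \<delta>" "\<delta> \<le> e1" "2 * \<delta> \<le> e2" "\<delta> \<le> e3" using e1(1) e2(1) e3(1) by (auto simp: \<delta>_def)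
  have est: "norm (x - x', l - l', z - z') \<le> 4 / m * norm (f (x, l) - f (x', l'), (z - \<Phi> x) - (z' - \<Phi> x'))"
    if near: "dist x xb < \<delta>" "dist x' xb < \<delta>" "dist l lb < \<delta>" "dist l' lb < \<delta>"
        "dist z (\<Phi> xb) < \<delta>" "dist z' (\<Phi> xb) < \<delta>"
      and mem: "(z, l) \<in> subgradient_rel E" "(z', l') \<in> subgradient_rel E" for x l z x' l' z'
  proof -
    define K where "K = norm (x - x', l - l', z - z')"
    define df where "df = f (x, l) - f (x', l')"
    define db where "db = (z - \<Phi> x) - (z' - \<Phi> x')"
    have zz: "z \<in> F" "z' \<in> F" using mem e1(3) near(3,4) \<delta>(2) by (force simp: F_def mem_conj_face)+
    have "z - z' = (z - \<Phi> xb) - (z' - \<Phi> xb)" by simp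
    also have "\<dots> \<in> S" unfolding S_def by (rule span_diff; rule span_base) (use zz in auto)
    finally have dz: "z - z' \<in> S" .
    have ll: "(\<Phi> xb, l) \<in> subgradient_rel E" "(\<Phi> xb, l') \<in> subgradient_rel E"
      using mem e1(2) near(5,6) \<delta>(2) by force+
    have dl: "(l - l') \<bullet> v = 0" if "v \<in> L" for v
      using L(1)[OF ll(1) that] L(1)[OF ll(2) that] by (simp add: inner_diff_left)
    have mono: "0 \<le> (z - z') \<bullet> (l - l')" using subgradient_rel_monotone[OF mem] .
    have 1: "m * K \<le> norm (H (x - x') + adjoint J (l - l')) + norm ((z - z') - J (x - x'))"
      unfolding K_def using m(2) dz dl mono by blast
    have d1: "dist (x, l) (xb, lb) < e2" "dist (x', l') (xb, lb) < e2"
      using norm_Pair_le[of "x - xb" "l - lb"] norm_Pair_le[of "x' - xb" "l' - lb"] near \<delta>(3)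
      by (simp_all add: dist_norm)
    have le: "norm (x - x', l - l') \<le> K" "norm (x - x') \<le> K"
    proof -
      show "norm (x - x') \<le> K" unfolding K_def by (rule norm_fst_le)
      show "norm (x - x', l - l') \<le> K"
        unfolding K_def norm_Pair[of "x - x'"] by (intro real_sqrt_le_mono add_left_mono power_mono norm_fst_le norm_ge_zero)
    qed
    have "norm (df - (H (x - x') + adjoint J (l - l'))) \<le> m / 4 * norm (x - x', l - l')"
      using e2(2)[OF d1] DH[of "x - x'" "l - l'"] by (simp add: df_def)
    also have "\<dots> \<le> m / 4 * K" using le(1) m4 by (intro mult_left_mono) auto
    finally have "norm (df - (H (x - x') + adjoint J (l - l'))) \<le> m / 4 * K" .
    moreover have "norm a \<le> norm df + norm (df - a)" for a
      using norm_triangle_ineq4[of df "df - a"] by simp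
    ultimately have 2: "norm (H (x - x') + adjoint J (l - l')) \<le> norm df + m / 4 * K"
      by (meson add_left_mono order_trans)
    have "norm (\<Phi> x - \<Phi> x' - J (x - x')) \<le> m / 4 * norm (x - x')" using e3(2) near(1,2) \<delta>(4) by force
    also have "\<dots> \<le> m / 4 * K" using le(2) m4 by (intro mult_left_mono) auto
    finally have "norm (\<Phi> x - \<Phi> x' - J (x - x')) \<le> m / 4 * K" .
    moreover have "(z - z') - J (x - x') = db + (\<Phi> x - \<Phi> x' - J (x - x'))" by (simp add: db_def)
    ultimately have 3: "norm ((z - z') - J (x - x')) \<le> norm db + m / 4 * K"
      using norm_triangle_ineq[of db "\<Phi> x - \<Phi> x' - J (x - x')"] by (simp only:)
    have "m * K \<le> 2 * (norm df + norm db)" using 1 2 3 by argo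
    also have "\<dots> \<le> 4 * norm (df, db)"
      using norm_fst_le[of df db] norm_snd_le[of db df] by argo
    finally have "K \<le> 4 / m * norm (df, db)" using m(1) by (simp add: field_simps)
    then show ?thesis unfolding K_def df_def db_def .
  qed
  show ?thesis using that[OF \<delta>(1), of "4 / m"] m(1) est by auto
qed

text \<open>The estimate yields uniqueness and the Lipschitz bound. Existence is a topological
  matter: the graph becomes a copy of 'b, so the system is a continuous map between spaces of equal
  dimension, injective by the estimate and hence open.\<close>

lemma generalized_equation_lipschitz_localization:
  fixes f :: "'a::euclidean_space \<times> 'b::euclidean_space \<Rightarrow> 'a" and \<Phi> :: "'a \<Rightarrow> 'b"
  assumes E: "convex E" "closed E" and zl: "(\<Phi> xb, lb) \<in> subgradient_rel E"
    and contf: "continuous_on UNIV f" and contPhi: "continuous_on UNIV \<Phi>" and f0: "f (xb, lb) = 0"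
    and S: "\<And>x l a b. (x, l) \<in> S (a, b) \<longleftrightarrow> f (x, l) = a \<and> (b + \<Phi> x, l) \<in> subgradient_rel E"
    and pos: "0 < \<delta>" "0 < c"
    and est: "\<And>x l z x' l' z'. \<lbrakk>dist x xb < \<delta>; dist x' xb < \<delta>; dist l lb < \<delta>; dist l' lb < \<delta>;
        dist z (\<Phi> xb) < \<delta>; dist z' (\<Phi> xb) < \<delta>;
        (z, l) \<in> subgradient_rel E; (z', l') \<in> subgradient_rel E\<rbrakk> \<Longrightarrow>
        norm (x - x', l - l', z - z') \<le> c * norm (f (x, l) - f (x', l'), (z - \<Phi> x) - (z' - \<Phi> x'))"
  shows "lip_sv_localization S (0, 0) (xb, lb)"
proof -
  define zb where "zb = \<Phi> xb"
  define vb where "vb = zb + lb"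
  obtain \<zeta> where \<zeta>: "\<And>v. (\<zeta> v, v - \<zeta> v) \<in> subgradient_rel E"
    using subgradient_rel_resolvent[OF E zl] by metis
  \<comment> \<open>Firm nonexpansiveness of the resolvent: by monotonicity, the cross term of the
    square is nonnegative.\<close>
  have expand: "(norm (\<zeta> v - \<zeta> v'))\<^sup>2 + (norm ((v - \<zeta> v) - (v' - \<zeta> v')))\<^sup>2 \<le> (norm (v - v'))\<^sup>2" for v v'
  proof -
    have sq: "(norm (a + b))\<^sup>2 = (norm a)\<^sup>2 + (norm b)\<^sup>2 + 2 * (a \<bullet> b)" for a b :: 'b
      by (simp add: power2_norm_eq_inner inner_add_left inner_add_right inner_commute)
    have "v - v' = (\<zeta> v - \<zeta> v') + ((v - \<zeta> v) - (v' - \<zeta> v'))" by simp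
    then have "(norm (v - v'))\<^sup>2 = (norm (\<zeta> v - \<zeta> v'))\<^sup>2 + (norm ((v - \<zeta> v) - (v' - \<zeta> v')))\<^sup>2
        + 2 * ((\<zeta> v - \<zeta> v') \<bullet> ((v - \<zeta> v) - (v' - \<zeta> v')))"
      by (metis sq)
    then show ?thesis using subgradient_rel_monotone[OF \<zeta>[of v] \<zeta>[of v']] by linarith
  qed
  have nz: "dist (\<zeta> v) (\<zeta> v') \<le> dist v v'" and nl: "dist (v - \<zeta> v) (v' - \<zeta> v') \<le> dist v v'" for v v'
  proof -
    show "dist (\<zeta> v) (\<zeta> v') \<le> dist v v'" unfolding dist_norm
      by (rule power2_le_imp_le[OF _ norm_ge_zero])
        (use expand[of v v'] zero_le_power2[of "norm ((v - \<zeta> v) - (v' - \<zeta> v'))"] in linarith)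
    show "dist (v - \<zeta> v) (v' - \<zeta> v') \<le> dist v v'" unfolding dist_norm
      by (rule power2_le_imp_le[OF _ norm_ge_zero])
        (use expand[of v v'] zero_le_power2[of "norm (\<zeta> v - \<zeta> v')"] in linarith)
  qed
  have \<zeta>u: "\<zeta> (z + l) = z" if "(z, l) \<in> subgradient_rel E" for z l
  proof -
    have "0 \<le> (z - \<zeta> (z + l)) \<bullet> (l - (z + l - \<zeta> (z + l)))" using subgradient_rel_monotone[OF that \<zeta>] .
    also have "l - (z + l - \<zeta> (z + l)) = - (z - \<zeta> (z + l))" by simp
    finally have "(z - \<zeta> (z + l)) \<bullet> (z - \<zeta> (z + l)) \<le> 0" by (simp only: inner_minus_right)
    then show ?thesis by (metis eq_iff_diff_eq_0 inner_gt_zero_iff not_less)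
  qed
  have cont\<zeta>: "continuous_on X \<zeta>" for X
    unfolding continuous_on_iff using nz by (meson le_less_trans)
  have \<zeta>b: "\<zeta> vb = zb" using \<zeta>u zl by (simp add: vb_def zb_def)
  \<comment> \<open>The right-hand side solved by \<open>x\<close> and the graph point
    \<open>(\<zeta> v, v - \<zeta> v)\<close>, as a single-valued function of
    \<open>(x, v)\<close>.\<close>
  define G where "G = (\<lambda>(x, v). (f (x, v - \<zeta> v), \<zeta> v - \<Phi> x))"
  have contG: "continuous_on X G" for X
    unfolding G_def case_prod_unfold
    by (intro continuous_intros continuous_on_compose2[OF contf] continuous_on_compose2[OF contPhi]
        continuous_on_compose2[OF cont\<zeta>[of UNIV]]) auto
  have "\<exists>d>0. \<forall>x. dist x xb < d \<longrightarrow> dist (\<Phi> x) zb < \<delta> / 2"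
    using contPhi pos(1) unfolding continuous_on_iff zb_def by (meson UNIV_I half_gt_zero)
  then obtain d where d: "0 < d" "\<And>x. dist x xb < d \<Longrightarrow> dist (\<Phi> x) zb < \<delta> / 2" by blast
  define d' where "d' = min d \<delta>"
  have d': "0 < d'" "d' \<le> d" "d' \<le> \<delta>" using d(1) pos(1) by (auto simp: d'_def)
  define Ob where "Ob = ball xb d' \<times> ball vb \<delta>"
  have Obd: "dist x xb < \<delta>" "dist (\<zeta> v) zb < \<delta>" "dist (v - \<zeta> v) lb < \<delta>" if "(x, v) \<in> Ob" for x v
  proof -
    have v: "dist v vb < \<delta>" and x: "dist x xb < d'" using that by (auto simp: Ob_def dist_commute)
    show "dist x xb < \<delta>" using x d'(3) by simp
    show "dist (\<zeta> v) zb < \<delta>" using nz[of v vb] v \<zeta>b by simp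
    have "vb - zb = lb" by (simp add: vb_def)
    then show "dist (v - \<zeta> v) lb < \<delta>" using nl[of v vb] v \<zeta>b by simp
  qed
  have "inj_on G Ob"
  proof (rule inj_onI, clarify)
    fix x v x' v' assume p: "(x, v) \<in> Ob" "(x', v') \<in> Ob" and eq: "G (x, v) = G (x', v')"
    have "f (x, v - \<zeta> v) - f (x', v' - \<zeta> v') = 0" "(\<zeta> v - \<Phi> x) - (\<zeta> v' - \<Phi> x') = 0"
      using eq by (auto simp: G_def)
    then have "norm (x - x', (v - \<zeta> v) - (v' - \<zeta> v'), \<zeta> v - \<zeta> v') \<le> 0"
      using est[of x x' "v - \<zeta> v" "v' - \<zeta> v'" "\<zeta> v" "\<zeta> v'"] Obd[OF p(1)] Obd[OF p(2)] \<zeta>[of v] \<zeta>[of v']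
      by (simp add: zb_def)
    then have "(x - x', (v - \<zeta> v) - (v' - \<zeta> v'), \<zeta> v - \<zeta> v') = (0, 0, 0)"
      unfolding norm_le_zero_iff zero_prod_def .
    then have "x = x'" "v - \<zeta> v = v' - \<zeta> v'" "\<zeta> v = \<zeta> v'"
      unfolding prod.inject right_minus_eq by blast+
    then show "x = x' \<and> v = v'" by (metis diff_add_cancel)
  qed
  moreover have "open Ob" unfolding Ob_def by (intro open_Times open_ball)
  ultimately have openG: "open (G ` Ob)" using invariance_of_domain contG by blast
  \<comment> \<open>Bounding the second component keeps \<open>z = b + \<Phi> x\<close> near
    \<open>zb\<close> for every solution in \<open>U\<close>, so that the estimate also covers
    solutions not known to come from \<open>Ob\<close>.\<close>
  define V where "V = G ` Ob \<inter> {y. dist (snd y) 0 < \<delta> / 2}"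
  have "open {y :: 'a \<times> 'b. dist (snd y) 0 < \<delta> / 2}"
    by (intro open_Collect_less continuous_intros)
  then have openV: "open V" unfolding V_def using openG by blast
  define U where "U = ball xb d' \<times> ball lb \<delta>"
  have openU: "open U" unfolding U_def by (intro open_Times open_ball)
  have zV: "(0, 0) \<in> V"
  proof -
    have "G (xb, vb) = (0, 0)" using \<zeta>b f0 by (simp add: G_def vb_def zb_def)
    moreover have "(xb, vb) \<in> Ob" using d' pos by (simp add: Ob_def)
    ultimately have "(0, 0) \<in> G ` Ob" by (metis imageI)
    then show ?thesis using pos by (simp add: V_def)
  qed
  have ex: "\<exists>p. p \<in> S y \<inter> U" if "y \<in> V" for y
  proof -
    have "y \<in> G ` Ob" using that by (simp add: V_def)
    then obtain x v where xv: "(x, v) \<in> Ob" "y = G (x, v)" by (metis imageE surj_pair)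
    have "(x, v - \<zeta> v) \<in> S y" unfolding xv(2) G_def by (simp add: S \<zeta>)
    moreover have "(x, v - \<zeta> v) \<in> U" using Obd(3)[OF xv(1)] xv(1) by (simp add: U_def Ob_def dist_commute)
    ultimately show ?thesis by blast
  qed
  have lip: "dist p p' \<le> c * dist y y'" if y: "y \<in> V" "y' \<in> V" and p: "p \<in> S y \<inter> U" "p' \<in> S y' \<inter> U" for y y' p p'
  proof -
    obtain x l x' l' where pp: "p = (x, l)" "p' = (x', l')" by (cases p, cases p')
    obtain a b a' b' where yy: "y = (a, b)" "y' = (a', b')" by (cases y, cases y')
    have s: "f (x, l) = a" "(b + \<Phi> x, l) \<in> subgradient_rel E" "f (x', l') = a'" "(b' + \<Phi> x', l') \<in> subgradient_rel E"
      using p S unfolding pp yy by blast+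
    have u: "dist x xb < d'" "dist l lb < \<delta>" "dist x' xb < d'" "dist l' lb < \<delta>"
      using p unfolding pp U_def by (auto simp: dist_commute)
    have bb: "norm b < \<delta> / 2" "norm b' < \<delta> / 2" using y unfolding yy V_def by auto
    have near: "dist (b + \<Phi> x) zb < \<delta>" if "norm b < \<delta> / 2" "dist x xb < d'" for b x
    proof -
      have "dist (\<Phi> x) zb < \<delta> / 2" using d(2) that(2) d'(2) by simp
      moreover have "norm (b + \<Phi> x - zb) \<le> norm b + norm (\<Phi> x - zb)"
        using norm_triangle_ineq[of b "\<Phi> x - zb"] by (simp add: add_diff_eq)
      ultimately show ?thesis using that(1) by (simp add: dist_norm)
    qed
    have "norm (x - x', l - l', (b + \<Phi> x) - (b' + \<Phi> x')) \<le> c * norm (a - a', b - b')"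
      using est[of x x' l l' "b + \<Phi> x" "b' + \<Phi> x'"] near[OF bb(1) u(1)] near[OF bb(2) u(3)] u d'(3) s
      by (simp add: zb_def)
    moreover have "norm (x - x', l - l') \<le> norm (x - x', l - l', (b + \<Phi> x) - (b' + \<Phi> x'))"
      unfolding norm_Pair[of "x - x'"] by (intro real_sqrt_le_mono add_left_mono power_mono norm_fst_le norm_ge_zero)
    ultimately show ?thesis unfolding pp yy dist_norm by simp
  qed
  obtain s where s: "\<And>y. y \<in> V \<Longrightarrow> s y \<in> S y \<inter> U" using ex by metis
  have uniq: "S y \<inter> U = {s y}" if "y \<in> V" for y
  proof -
    have "p = s y" if "p \<in> S y \<inter> U" for p
      using lip[OF \<open>y \<in> V\<close> \<open>y \<in> V\<close> that s[OF \<open>y \<in> V\<close>]] by simp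
    then show ?thesis using s[OF that] by blast
  qed
  have "c-lipschitz_on V s"
    using lip s pos(2) by (intro lipschitz_onI) auto
  moreover have "(xb, lb) \<in> U" using d' pos by (simp add: U_def)
  ultimately show ?thesis
    unfolding lip_sv_localization_def using openU openV zV uniq by blast
qed

theorem theorem5p2:
  fixes \<phi> :: "'a::euclidean_space \<Rightarrow> real"
    and \<Phi> :: "'a \<Rightarrow> 'b::euclidean_space"
    and g :: "'b \<Rightarrow> ereal"
    and xb :: 'a and lb :: 'b
  assumes "C2 \<phi>" and "C2 \<Phi>" and "polyhedral_fun g"
    and KKT1: "gradL \<phi> \<Phi> xb lb = 0"
    and KKT2: "lb \<in> subdiff g (\<Phi> xb)"
  shows "(metrically_regular (Psi \<phi> \<Phi> g) (xb, lb) (0, 0)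
            \<longleftrightarrow> strongly_metrically_regular (Psi \<phi> \<Phi> g) (xb, lb) (0, 0))
       \<and> (strongly_metrically_regular (Psi \<phi> \<Phi> g) (xb, lb) (0, 0)
            \<longleftrightarrow> lip_sv_localization (S_KKT \<phi> \<Phi> g) (0, 0) (xb, lb))
       \<and> (lip_sv_localization (S_KKT \<phi> \<Phi> g) (0, 0) (xb, lb)
            \<longleftrightarrow> (\<forall>w w'.
                   frechet_derivative (\<lambda>x. gradL \<phi> \<Phi> x lb) (at xb) w
                     + adjoint (frechet_derivative \<Phi> (at xb)) w' = 0
                   \<and> w' \<in> coderiv (subdiff g) (\<Phi> xb, lb) (frechet_derivative \<Phi> (at xb) w)
                   \<longrightarrow> w = 0 \<and> w' = 0))"
proof -
  define E where "E = epigraph g"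
  have pg: "proper_fun g" and pE: "polyhedron E"
    using assms(3) unfolding polyhedral_fun_def E_def by blast+
  have cE: "convex E" "closed E" using pE polyhedron_imp_convex polyhedron_imp_closed by blast+
  define f where "f = (\<lambda>p. gradL \<phi> \<Phi> (fst p) (snd p))"
  define H where "H = frechet_derivative (\<lambda>x. gradL \<phi> \<Phi> x lb) (at xb)"
  define J where "J = frechet_derivative \<Phi> (at xb)"
  obtain D where D: "\<And>p. (f has_derivative D p) (at p)" "\<And>h. continuous_on UNIV (\<lambda>p. D p h)"
    "\<And>h \<mu>. D (xb, lb) (h, \<mu>) = H h + adjoint J \<mu>" "linear H" "\<And>v w. H v \<bullet> w = v \<bullet> H w"
    by (rule gradL_derivative[OF assms(1,2)]) (rule that; simp only: f_def H_def J_def)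
  obtain \<Phi>' \<Phi>'' where Phi: "\<And>x. (\<Phi> has_derivative blinfun_apply (\<Phi>' x)) (at x)"
    "\<And>x. (\<Phi>' has_derivative blinfun_apply (\<Phi>'' x)) (at x)"
    using assms(2) unfolding C2_def by blast
  have "(\<Phi> has_derivative J) (at xb)"
    using Phi(1) frechet_derivative_at unfolding J_def by metis
  then have J: "(\<Phi> has_derivative J) (at xb)" "linear J" "J = blinfun_apply (\<Phi>' xb)"
    using has_derivative_linear has_derivative_unique[OF _ Phi(1)] by blast+
  have "continuous_on UNIV \<Phi>'"
    by (rule has_derivative_continuous_on[where f' = "\<lambda>x. blinfun_apply (\<Phi>'' x)"])
      (rule has_derivative_at_withinI[OF Phi(2)])
  then have contPhi': "continuous_on UNIV (\<lambda>x. \<Phi>' x h)" for h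
    by (intro continuous_intros blinfun.continuous_on)
  have strictPhi: "\<exists>d>0. \<forall>x y. dist x xb < d \<longrightarrow> dist y xb < d \<longrightarrow>
        norm (\<Phi> x - \<Phi> y - J (x - y)) \<le> e * norm (x - y)" if "0 < e" for e
    using has_derivative_strict[OF Phi(1) contPhi' that, of xb] unfolding J(3) by metis
  have contPhi: "continuous_on UNIV \<Phi>" and contf: "continuous_on UNIV f"
    using Phi(1) D(1) by (meson continuous_at_imp_continuous_on has_derivative_continuous)+
  have graph: "graph (subdiff g) = subgradient_rel E"
    using subdiff_iff_subgradient_rel[OF pg] unfolding graph_def E_def by auto
  have f0: "f (xb, lb) = 0" using KKT1 by (simp add: f_def)
  have zl: "(\<Phi> xb, lb) \<in> subgradient_rel E" using KKT2 graph by (auto simp: graph_def)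
  have S: "(x, l) \<in> S_KKT \<phi> \<Phi> g (a, b) \<longleftrightarrow> f (x, l) = a \<and> (b + \<Phi> x, l) \<in> subgradient_rel E" for x l a b
    using mem_S_KKT_iff[OF pg] cE unfolding f_def E_def by simp
  define cond where "cond \<longleftrightarrow> (\<forall>w w'. H w + adjoint J w' = 0
      \<and> (w', - J w) \<in> limiting_normal (subgradient_rel E) (\<Phi> xb, lb) \<longrightarrow> w = 0 \<and> w' = 0)"
  \<comment> \<open>With \<open>S_KKT\<close> as the inverse of \<open>Psi\<close>, both notions
    unfold to the same formula.\<close>
  have bc: "strongly_metrically_regular (Psi \<phi> \<Phi> g) (xb, lb) (0, 0)
      \<longleftrightarrow> lip_sv_localization (S_KKT \<phi> \<Phi> g) (0, 0) (xb, lb)"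
    unfolding strongly_metrically_regular_def lip_sv_localization_def S_KKT_def ..
  have ba: "metrically_regular (Psi \<phi> \<Phi> g) (xb, lb) (0, 0)"
    if "strongly_metrically_regular (Psi \<phi> \<Phi> g) (xb, lb) (0, 0)"
    using strongly_metrically_regular_imp_metrically_regular[OF that] .
  have ad: cond if mr: "metrically_regular (Psi \<phi> \<Phi> g) (xb, lb) (0, 0)"
  proof -
    obtain \<kappa> e where pos: "0 < \<kappa>" "0 < e" and reg: "\<And>x y y'. \<lbrakk>dist x (xb, lb) < e; dist y (0, 0) < e;
        y' \<in> Psi \<phi> \<Phi> g x\<rbrakk> \<Longrightarrow> \<exists>x'. y \<in> Psi \<phi> \<Phi> g x' \<and> dist x x' \<le> \<kappa> * dist y y'"
      using metrically_regularE[OF mr] by metis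
    have Psi: "(a, b) \<in> Psi \<phi> \<Phi> g X \<longleftrightarrow> f X = a \<and> (b + \<Phi> (fst X), snd X) \<in> subgradient_rel E" for a b X
      using S[of "fst X" "snd X" a b] by (simp add: S_KKT_def inv_map_def)
    have reg': "\<exists>X. f X = a \<and> (b + \<Phi> (fst X), snd X) \<in> subgradient_rel E \<and>
        dist (x, l) X \<le> \<kappa> * dist (a, b) (f (x, l), z - \<Phi> x)"
      if "dist (x, l) (xb, lb) < e" "dist (a, b) 0 < e" "(z, l) \<in> subgradient_rel E" for x l z a b
      using reg[of "(x, l)" "(a, b)" "(f (x, l), z - \<Phi> x)"] that unfolding Psi zero_prod_def by auto
    show cond
      unfolding cond_def
      using coderivative_condition_necessary[OF D(1-3,5) J(1) f0 pos reg'] by blast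
  qed
  have db: "lip_sv_localization (S_KKT \<phi> \<Phi> g) (0, 0) (xb, lb)" if c: cond
  proof -
    obtain \<delta> c where "0 < \<delta>" "0 < c"
      "\<And>x l z x' l' z'. \<lbrakk>dist x xb < \<delta>; dist x' xb < \<delta>; dist l lb < \<delta>; dist l' lb < \<delta>;
        dist z (\<Phi> xb) < \<delta>; dist z' (\<Phi> xb) < \<delta>;
        (z, l) \<in> subgradient_rel E; (z', l') \<in> subgradient_rel E\<rbrakk> \<Longrightarrow>
        norm (x - x', l - l', z - z') \<le> c * norm (f (x, l) - f (x', l'), (z - \<Phi> x) - (z' - \<Phi> x'))"
      using generalized_equation_estimate[OF pE zl D J(2) strictPhi] c unfolding cond_def by blast
    then show ?thesis
      by (rule generalized_equation_lipschitz_localization[OF cE zl contf contPhi f0 S])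
  qed
  have "(\<forall>w w'. frechet_derivative (\<lambda>x. gradL \<phi> \<Phi> x lb) (at xb) w
                     + adjoint (frechet_derivative \<Phi> (at xb)) w' = 0
                   \<and> w' \<in> coderiv (subdiff g) (\<Phi> xb, lb) (frechet_derivative \<Phi> (at xb) w)
                   \<longrightarrow> w = 0 \<and> w' = 0) \<longleftrightarrow> cond"
    unfolding cond_def H_def[symmetric] J_def[symmetric] coderiv_def graph by simp
  then show ?thesis using bc ba ad db by blast
qed

end
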